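(* Let $X,Y$ be complex Banach spaces and let $J\subset \mathcal{K}(X,Y)\subset \mathcal{L}(X,Y)$ be an $M$-ideal in $\mathcal{L}(X,Y)$. For any $A\in\mathcal{L}(X,Y)$ with $\|A\|=1$ and $d(A,J)<1$, $$\partial_A=\overline{CO}\{x^{**}\otimes y^*\in \partial_e J^*_1 : x^{**}(A^*(y^* ))=1,\ x^{**}\in\partial_e X^{**}_1,\ y^*\in\partial_e Y^*_1\},$$ where the closure is taken in the weak$^*$-topology of $\mathcal{L}(X,Y)^*$.
   Context: $\mathcal{L}(X,Y)$ is the space of bounded operators from $X$ to $Y$ with the operator norm and $\mathcal{K}(X,Y)$ its subspace of compact operators. For a vector $v$ in a Banach space $E$, $\partial_v=\{f\in E^*:\|f\|=1,\ f(v)=\|v\|\}$; in particular $\partial_A=\{\Lambda\in\mathcal{L}(X,Y)^*:\|\Lambda\|=1,\ \Lambda(A)=\|A\|\}$. $E_1$ is the closed unit ball of $E$, $\partial_e C$ is the set of extreme points of a convex set $C$, $CO$ denotes convex hull, the bar denotes closure, and $d(\cdot,\cdot)$ is norm distance. For $x^{**}\in X^{**}$, $y^*\in Y^*$, $x^{**}\otimes y^*$ is the functional $(x^{**}\otimes y^* )(T)=x^{**}(T^*(y^* ))$. A closed subspace $J$ of a Banach space $E$ is an $M$-ideal if there is a linear projection $P:E^*\to E^*$ with $\ker P=J^\perp$ (annihilator) and $\|e^*\|=\|P(e^* )\|+\|e^*-P(e^* )\|$ for all $e^*\in E^*$. In this case functionals in $J^*$ have unique norm-preserving extensions to $E$ and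 $J^*$ is identified with the range of $P$, so $E^*=J^*\oplus_1 J^\perp$; elements of $J^*$ are thus regarded as functionals on $E$. *)

theory Defs
  imports "HOL-Analysis.Analysis"
begin

section \<open>Complex normed and complex Banach spaces\<close>

class complex_vector = real_vector +
  fixes scaleC :: "complex \<Rightarrow> 'a \<Rightarrow> 'a"  (infixr \<open>*\<^sub>C\<close> 75)
  assumes scaleC_add_right: "c *\<^sub>C (x + y) = c *\<^sub>C x + c *\<^sub>C y"
    and scaleC_add_left: "(c + d) *\<^sub>C x = c *\<^sub>C x + d *\<^sub>C x"
    and scaleC_scaleC: "c *\<^sub>C d *\<^sub>C x = (c * d) *\<^sub>C x"
    and scaleC_of_real: "complex_of_real r *\<^sub>C x = r *\<^sub>R x"

class complex_normed_vector = complex_vector + real_normed_vector +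
  assumes norm_scaleC: "norm (c *\<^sub>C x) = cmod c * norm x"

class complex_banach = complex_normed_vector + banach

instantiation complex :: complex_banach
begin
definition scaleC_complex :: "complex \<Rightarrow> complex \<Rightarrow> complex"
  where "scaleC_complex c x = c * x"
instance
  by standard (simp_all add: scaleC_complex_def algebra_simps scaleR_conv_of_real norm_mult)
end

lemma vector_space_scaleC: "vector_space (scaleC :: complex \<Rightarrow> 'a \<Rightarrow> 'a::complex_vector)"
proof
  show "1 *\<^sub>C x = x" for x :: 'a
    using scaleC_of_real[of 1 x] by simp
qed (simp_all add: scaleC_add_right scaleC_add_left scaleC_scaleC)

section \<open>Bounded complex-linear operators\<close>

definition bounded_clinear :: "('a::complex_normed_vector \<Rightarrow> 'b::complex_normed_vector) \<Rightarrow> bool"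
  where "bounded_clinear f \<longleftrightarrow> bounded_linear f \<and> (\<forall>c x. f (c *\<^sub>C x) = c *\<^sub>C f x)"

lemma bounded_clinear_bounded_linear: "bounded_clinear f \<Longrightarrow> bounded_linear f"
  by (simp add: bounded_clinear_def)

lemma bounded_clinear_scaleC: "bounded_clinear f \<Longrightarrow> f (c *\<^sub>C x) = c *\<^sub>C f x"
  by (simp add: bounded_clinear_def)

lemma bounded_clinearI:
  assumes "\<And>x y. f (x + y) = f x + f y" "\<And>c x. f (c *\<^sub>C x) = c *\<^sub>C f x"
    and "\<And>x. norm (f x) \<le> norm x * K"
  shows "bounded_clinear f"
proof -
  have "f (r *\<^sub>R x) = r *\<^sub>R f x" for r x
    using assms(2)[of "complex_of_real r" x] by (simp add: scaleC_of_real)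
  then show ?thesis
    unfolding bounded_clinear_def using assms bounded_linear_intro by blast
qed

lemma scaleC_zero_right: "c *\<^sub>C (0::'a::complex_vector) = 0"
  using scaleC_add_right[of c "0::'a" 0] by simp

lemma scaleC_minus_right: "c *\<^sub>C (- x) = - (c *\<^sub>C x)" for x :: "'a::complex_vector"
  using scaleC_add_right[of c x "- x"] by (simp add: scaleC_zero_right eq_neg_iff_add_eq_0 add.commute)

lemma scaleC_diff_right: "c *\<^sub>C (x - y) = c *\<^sub>C x - c *\<^sub>C y" for x :: "'a::complex_vector"
  using scaleC_add_right[of c x "- y"] by (simp add: scaleC_minus_right)

typedef (overloaded) ('a, 'b) cblinfun
  = "{f :: 'a::complex_normed_vector \<Rightarrow> 'b::complex_normed_vector. bounded_clinear f}"
  morphisms cblinfun_apply CBlinfun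
  by (rule exI[of _ "\<lambda>_. 0"]) (auto intro!: bounded_clinearI[where K = 0] simp: scaleC_zero_right)

type_notation cblinfun (\<open>(_ \<Rightarrow>\<^sub>C\<^sub>L /_)\<close> [22, 21] 21)

declare [[coercion
  "cblinfun_apply :: ('a::complex_normed_vector \<Rightarrow>\<^sub>C\<^sub>L 'b::complex_normed_vector) \<Rightarrow> 'a \<Rightarrow> 'b"]]

setup_lifting type_definition_cblinfun

type_synonym 'a dual = "'a \<Rightarrow>\<^sub>C\<^sub>L complex"

lemma bounded_clinear_cblinfun_apply: "bounded_clinear (cblinfun_apply T)"
  using cblinfun_apply by auto

lemma cblinfun_eqI: "(\<And>x. cblinfun_apply S x = cblinfun_apply T x) \<Longrightarrow> S = T"
  by transfer auto

lemmas bounded_linear_cblinfun_apply =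
  bounded_clinear_bounded_linear[OF bounded_clinear_cblinfun_apply]

instantiation cblinfun :: (complex_normed_vector, complex_normed_vector) complex_normed_vector
begin

lift_definition norm_cblinfun :: "'a \<Rightarrow>\<^sub>C\<^sub>L 'b \<Rightarrow> real" is onorm .

lift_definition zero_cblinfun :: "'a \<Rightarrow>\<^sub>C\<^sub>L 'b" is "\<lambda>_. 0"
  by (auto intro!: bounded_clinearI[where K = 0] simp: scaleC_zero_right)

lift_definition plus_cblinfun :: "'a \<Rightarrow>\<^sub>C\<^sub>L 'b \<Rightarrow> 'a \<Rightarrow>\<^sub>C\<^sub>L 'b \<Rightarrow> 'a \<Rightarrow>\<^sub>C\<^sub>L 'b"
  is "\<lambda>f g x. f x + g x"
  by (auto simp: bounded_clinear_def scaleC_add_right bounded_linear_add)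

lift_definition minus_cblinfun :: "'a \<Rightarrow>\<^sub>C\<^sub>L 'b \<Rightarrow> 'a \<Rightarrow>\<^sub>C\<^sub>L 'b \<Rightarrow> 'a \<Rightarrow>\<^sub>C\<^sub>L 'b"
  is "\<lambda>f g x. f x - g x"
  by (auto simp: bounded_clinear_def scaleC_diff_right bounded_linear_sub)

lift_definition uminus_cblinfun :: "'a \<Rightarrow>\<^sub>C\<^sub>L 'b \<Rightarrow> 'a \<Rightarrow>\<^sub>C\<^sub>L 'b" is "\<lambda>f x. - f x"
  by (auto simp: bounded_clinear_def scaleC_minus_right bounded_linear_minus)

lemma bounded_clinear_scaleC_fun:
  assumes "bounded_clinear f"
  shows "bounded_clinear (\<lambda>x. c *\<^sub>C f x)"
proof -
  obtain K where K: "\<And>x. norm (f x) \<le> norm x * K"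
    using bounded_linear.bounded[OF bounded_clinear_bounded_linear[OF assms]] by blast
  show ?thesis
  proof (rule bounded_clinearI[where K = "cmod c * K"])
    show "c *\<^sub>C f (x + y) = c *\<^sub>C f x + c *\<^sub>C f y" for x y
      using bounded_clinear_bounded_linear[OF assms]
      by (simp add: linear_simps(1) scaleC_add_right)
    show "c *\<^sub>C f (d *\<^sub>C x) = d *\<^sub>C c *\<^sub>C f x" for d x
      using assms by (simp add: bounded_clinear_scaleC scaleC_scaleC mult.commute)
    show "norm (c *\<^sub>C f x) \<le> norm x * (cmod c * K)" for x
      using mult_left_mono[OF K[of x], of "cmod c"] by (simp add: norm_scaleC mult.left_commute)
  qed
qed

lift_definition scaleC_cblinfun :: "complex \<Rightarrow> 'a \<Rightarrow>\<^sub>C\<^sub>L 'b \<Rightarrow> 'a \<Rightarrow>\<^sub>C\<^sub>L 'b"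
  is "\<lambda>c f x. c *\<^sub>C f x"
  by (rule bounded_clinear_scaleC_fun)

definition scaleR_cblinfun :: "real \<Rightarrow> 'a \<Rightarrow>\<^sub>C\<^sub>L 'b \<Rightarrow> 'a \<Rightarrow>\<^sub>C\<^sub>L 'b"
  where "scaleR_cblinfun r T = complex_of_real r *\<^sub>C T"

definition dist_cblinfun :: "'a \<Rightarrow>\<^sub>C\<^sub>L 'b \<Rightarrow> 'a \<Rightarrow>\<^sub>C\<^sub>L 'b \<Rightarrow> real"
  where "dist_cblinfun S T = norm (S - T)"

definition sgn_cblinfun :: "'a \<Rightarrow>\<^sub>C\<^sub>L 'b \<Rightarrow> 'a \<Rightarrow>\<^sub>C\<^sub>L 'b"
  where "sgn_cblinfun T = inverse (norm T) *\<^sub>R T"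

definition [code del]:
  "(uniformity :: (('a \<Rightarrow>\<^sub>C\<^sub>L 'b) \<times> ('a \<Rightarrow>\<^sub>C\<^sub>L 'b)) filter) =
     (INF e\<in>{0 <..}. principal {(S, T). dist S T < e})"

definition open_cblinfun :: "('a \<Rightarrow>\<^sub>C\<^sub>L 'b) set \<Rightarrow> bool"
  where [code del]:
    "open_cblinfun U = (\<forall>S\<in>U. \<forall>\<^sub>F (S', T) in uniformity. S' = S \<longrightarrow> T \<in> U)"

instance
proof
  fix S T U :: "'a \<Rightarrow>\<^sub>C\<^sub>L 'b" and V :: "('a \<Rightarrow>\<^sub>C\<^sub>L 'b) set" and a b :: real and c d :: complex
  show "dist S T = norm (S - T)" by (rule dist_cblinfun_def)
  show "sgn T = inverse (norm T) *\<^sub>R T" by (rule sgn_cblinfun_def)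
  show "uniformity = (INF e\<in>{0 <..}. principal {(S :: 'a \<Rightarrow>\<^sub>C\<^sub>L 'b, T). dist S T < e})"
    by (rule uniformity_cblinfun_def)
  show "open V = (\<forall>S\<in>V. \<forall>\<^sub>F (S', T) in uniformity. S' = S \<longrightarrow> T \<in> V)"
    by (rule open_cblinfun_def)
  show "S + T + U = S + (T + U)" by transfer (simp add: add.assoc)
  show "S + T = T + S" by transfer (simp add: add.commute)
  show "0 + S = S" by transfer simp
  show "- S + S = 0" by transfer simp
  show "S - T = S + - T" by transfer simp
  show "c *\<^sub>C (S + T) = c *\<^sub>C S + c *\<^sub>C T" by transfer (simp add: scaleC_add_right)
  show "(c + d) *\<^sub>C S = c *\<^sub>C S + d *\<^sub>C S" by transfer (simp add: scaleC_add_left)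
  show "c *\<^sub>C d *\<^sub>C S = (c * d) *\<^sub>C S" by transfer (simp add: scaleC_scaleC)
  show "complex_of_real a *\<^sub>C S = a *\<^sub>R S" by (simp add: scaleR_cblinfun_def)
  show "a *\<^sub>R (S + T) = a *\<^sub>R S + a *\<^sub>R T"
    unfolding scaleR_cblinfun_def by transfer (simp add: scaleC_add_right)
  show "(a + b) *\<^sub>R S = a *\<^sub>R S + b *\<^sub>R S"
    unfolding scaleR_cblinfun_def by transfer (simp add: scaleC_add_left)
  show "a *\<^sub>R b *\<^sub>R S = (a * b) *\<^sub>R S"
    unfolding scaleR_cblinfun_def by transfer (simp add: scaleC_scaleC)
  show "1 *\<^sub>R S = S"
    unfolding scaleR_cblinfun_def by transfer (simp only: scaleC_of_real scaleR_one)
  have norm_scaleR: "norm (a *\<^sub>R S) = \<bar>a\<bar> * norm S" for a and S :: "'a \<Rightarrow>\<^sub>C\<^sub>L 'b"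
    unfolding scaleR_cblinfun_def
    by transfer (simp add: scaleC_of_real onorm_scaleR bounded_clinear_bounded_linear)
  show "norm (a *\<^sub>R S) = \<bar>a\<bar> * norm S" by (rule norm_scaleR)
  show "(norm S = 0) = (S = 0)"
    by transfer (simp add: fun_eq_iff onorm_eq_0 bounded_clinear_bounded_linear)
  show "norm (S + T) \<le> norm S + norm T"
    by transfer (simp add: onorm_triangle bounded_clinear_bounded_linear)
  have le: "onorm (\<lambda>x. c *\<^sub>C f x) \<le> cmod c * onorm f"
    if "bounded_clinear f" for c :: complex and f :: "'a \<Rightarrow> 'b"
  proof (rule onorm_bound)
    have bl: "bounded_linear f" using that by (rule bounded_clinear_bounded_linear)
    then show "0 \<le> cmod c * onorm f" by (simp add: onorm_pos_le)
    show "norm (c *\<^sub>C f x) \<le> cmod c * onorm f * norm x" for x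
      using mult_left_mono[OF onorm[OF bl, of x], of "cmod c"]
      by (simp add: norm_scaleC mult.assoc)
  qed
  show "norm (c *\<^sub>C S) = cmod c * norm S"
  proof transfer
    fix c :: complex and f :: "'a \<Rightarrow> 'b"
    assume f: "bounded_clinear f"
    show "onorm (\<lambda>x. c *\<^sub>C f x) = cmod c * onorm f"
    proof (cases "c = 0")
      case True
      have "0 *\<^sub>C x = 0" for x :: 'b using scaleC_of_real[of 0 x] by simp
      with True show ?thesis by (simp add: onorm_zero)
    next
      case False
      have one: "1 *\<^sub>C x = x" for x :: 'b using scaleC_of_real[of 1 x] by simp
      have "onorm f \<le> cmod (inverse c) * onorm (\<lambda>x. c *\<^sub>C f x)"
        using le[OF bounded_clinear_scaleC_fun[OF f], of "inverse c" c] False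
        by (simp add: scaleC_scaleC one)
      with False have "cmod c * onorm f \<le> onorm (\<lambda>x. c *\<^sub>C f x)"
        by (simp add: norm_divide field_simps)
      with le[OF f, of c] show ?thesis by simp
    qed
  qed
qed

end

lemma norm_cblinfun: "norm (cblinfun_apply T x) \<le> norm T * norm x"
  by transfer (simp add: onorm bounded_clinear_bounded_linear)

lemma norm_cblinfun_bound:
  "0 \<le> b \<Longrightarrow> (\<And>x. norm (cblinfun_apply T x) \<le> b * norm x) \<Longrightarrow> norm T \<le> b"
  by transfer (rule onorm_bound)

instance cblinfun :: (complex_normed_vector, complex_banach) complex_banach
proof
  fix T :: "nat \<Rightarrow> 'a \<Rightarrow>\<^sub>C\<^sub>L 'b"
  assume "Cauchy T"
  define F where "F n = Blinfun (cblinfun_apply (T n))" for n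
  have F: "blinfun_apply (F n) = cblinfun_apply (T n)" for n
    by (simp add: F_def bounded_linear_Blinfun_apply bounded_linear_cblinfun_apply)
  have isom: "norm (F n - G) = norm (T n - S)"
    if "blinfun_apply G = cblinfun_apply S" for n G S
    by (simp add: norm_blinfun.rep_eq norm_cblinfun.rep_eq minus_cblinfun.rep_eq
        minus_blinfun.rep_eq F that)
  have "Cauchy F"
    using \<open>Cauchy T\<close> by (simp add: Cauchy_def dist_norm isom F)
  then obtain G where G: "F \<longlonglongrightarrow> G"
    using Cauchy_convergent_iff convergent_def by blast
  have lim: "(\<lambda>n. cblinfun_apply (T n) x) \<longlonglongrightarrow> blinfun_apply G x" for x
    using blinfun.tendsto[OF G tendsto_const, of x] by (simp add: F)
  have sc: "bounded_linear (\<lambda>y::'b. c *\<^sub>C y)" for c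
    using bounded_clinear_bounded_linear[OF bounded_clinear_scaleC_fun[of "\<lambda>y::'b. y" c]]
    by (simp add: bounded_clinear_def bounded_linear_ident)
  have "blinfun_apply G (c *\<^sub>C x) = c *\<^sub>C blinfun_apply G x" for c x
  proof (rule LIMSEQ_unique[OF lim])
    have "cblinfun_apply (T n) (c *\<^sub>C x) = c *\<^sub>C cblinfun_apply (T n) x" for n
      by (rule bounded_clinear_scaleC[OF bounded_clinear_cblinfun_apply])
    then show "(\<lambda>n. cblinfun_apply (T n) (c *\<^sub>C x)) \<longlonglongrightarrow> c *\<^sub>C blinfun_apply G x"
      using bounded_linear.tendsto[OF sc lim] by simp
  qed
  then have "bounded_clinear (blinfun_apply G)"
    by (simp add: bounded_clinear_def blinfun.bounded_linear_right)
  then have S: "blinfun_apply G = cblinfun_apply (CBlinfun (blinfun_apply G))"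
    by (simp add: CBlinfun_inverse)
  have "T \<longlonglongrightarrow> CBlinfun (blinfun_apply G)"
    using G by (simp add: LIMSEQ_def dist_norm isom[OF S])
  then show "convergent T" by (auto simp: convergent_def)
qed

definition compact_operators :: "('a::complex_normed_vector \<Rightarrow>\<^sub>C\<^sub>L 'b::complex_normed_vector) set"
  where "compact_operators = {T. compact (closure (cblinfun_apply T ` cball 0 1))}"

section \<open>Duality\<close>

lift_definition cblinfun_compose ::
    "'b::complex_normed_vector \<Rightarrow>\<^sub>C\<^sub>L 'c::complex_normed_vector \<Rightarrow>
     'a::complex_normed_vector \<Rightarrow>\<^sub>C\<^sub>L 'b \<Rightarrow> 'a \<Rightarrow>\<^sub>C\<^sub>L 'c"
  is "\<lambda>g f x. g (f x)"
  by (auto simp: bounded_clinear_def intro: bounded_linear_compose)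

lemma norm_cblinfun_compose: "norm (cblinfun_compose S T) \<le> norm S * norm T"
  using onorm_compose[OF bounded_linear_cblinfun_apply bounded_linear_cblinfun_apply, of S T]
  by (simp add: norm_cblinfun.rep_eq cblinfun_compose.rep_eq comp_def)

text \<open>The Banach space adjoint \<open>T\<^sup>*: Y\<^sup>* \<rightarrow> X\<^sup>*\<close>, \<open>T\<^sup>* y\<^sup>* = y\<^sup>* \<circ> T\<close>; it is complex-linear
  (no conjugation).\<close>

lift_definition adj ::
    "'a::complex_normed_vector \<Rightarrow>\<^sub>C\<^sub>L 'b::complex_normed_vector \<Rightarrow> 'b dual \<Rightarrow>\<^sub>C\<^sub>L 'a dual"
  is "\<lambda>T f. cblinfun_compose f T"
proof -
  fix T :: "'a \<Rightarrow>\<^sub>C\<^sub>L 'b"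
  show "bounded_clinear (\<lambda>f :: 'b dual. cblinfun_compose f T)"
  proof (rule bounded_clinearI[where K = "norm T"])
    show "norm (cblinfun_compose f T) \<le> norm f * norm T" for f :: "'b dual"
      by (rule norm_cblinfun_compose)
  qed (transfer, simp)+
qed

lemma adj_apply: "adj T f x = f (T x)"
  by (simp add: adj.rep_eq cblinfun_compose.rep_eq)

lemma norm_adj_le: "norm (adj T) \<le> norm T"
proof (rule norm_cblinfun_bound)
  show "norm (cblinfun_apply (adj T) f) \<le> norm T * norm f" for f
    using norm_cblinfun_compose[of f T] by (simp add: adj.rep_eq mult.commute)
qed simp

lift_definition tensor_functional ::
    "'a::complex_normed_vector dual dual \<Rightarrow> 'b::complex_normed_vector dual
      \<Rightarrow> ('a \<Rightarrow>\<^sub>C\<^sub>L 'b) dual"  (infixr \<open>\<otimes>\<^sub>f\<close> 70)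
  is "\<lambda>x y T. cblinfun_apply x (cblinfun_apply (adj T) y)"
proof -
  fix x :: "'a dual dual" and y :: "'b dual"
  have bc: "bounded_clinear (cblinfun_apply x)" "bounded_clinear (cblinfun_apply y)"
    by (rule bounded_clinear_cblinfun_apply)+
  have add: "adj (S + T) y = adj S y + adj T y" for S T :: "'a \<Rightarrow>\<^sub>C\<^sub>L 'b"
    by (rule cblinfun_eqI) (simp add: adj_apply plus_cblinfun.rep_eq
        linear_simps(1)[OF bounded_clinear_bounded_linear[OF bc(2)]])
  have scale: "adj (c *\<^sub>C T) y = c *\<^sub>C adj T y" for c and T :: "'a \<Rightarrow>\<^sub>C\<^sub>L 'b"
    by (rule cblinfun_eqI) (simp add: adj_apply scaleC_cblinfun.rep_eq bounded_clinear_scaleC[OF bc(2)])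
  show "bounded_clinear (\<lambda>T :: 'a \<Rightarrow>\<^sub>C\<^sub>L 'b. cblinfun_apply x (cblinfun_apply (adj T) y))"
  proof (rule bounded_clinearI[where K = "norm x * norm y"])
    show "x (adj (S + T) y) = x (adj S y) + x (adj T y)" for S T :: "'a \<Rightarrow>\<^sub>C\<^sub>L 'b"
      by (simp add: add linear_simps(1)[OF bounded_clinear_bounded_linear[OF bc(1)]])
    show "x (adj (c *\<^sub>C T) y) = c *\<^sub>C x (adj T y)" for c and T :: "'a \<Rightarrow>\<^sub>C\<^sub>L 'b"
      by (simp add: scale bounded_clinear_scaleC[OF bc(1)])
    show "norm (x (adj T y)) \<le> norm T * (norm x * norm y)" for T :: "'a \<Rightarrow>\<^sub>C\<^sub>L 'b"
    proof -
      have "norm (x (adj T y)) \<le> norm x * norm (adj T y)"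
        by (rule norm_cblinfun)
      also have "\<dots> \<le> norm x * (norm y * norm T)"
        by (simp add: adj.rep_eq norm_cblinfun_compose mult_left_mono)
      finally show ?thesis by (simp add: mult_ac)
    qed
  qed
qed

lemma tensor_functional_apply: "cblinfun_apply (x \<otimes>\<^sub>f y) T = x (adj T y)"
  by (simp add: tensor_functional.rep_eq)

text \<open>On functions, \<open>euclidean\<close> is the product topology, so this is the topology of pointwise
  convergence on \<open>E\<close>.\<close>

definition weak_star :: "'a::complex_normed_vector dual topology"
  where "weak_star = pullback_topology UNIV cblinfun_apply euclidean"

definition support_functionals :: "'a::complex_normed_vector \<Rightarrow> 'a dual set"
  where "support_functionals v = {f. norm f = 1 \<and> cblinfun_apply f v = complex_of_real (norm v)}"

section \<open>M-ideals\<close>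

definition annihilator :: "'a::complex_normed_vector set \<Rightarrow> 'a dual set"
  where "annihilator J = {f. \<forall>x\<in>J. cblinfun_apply f x = 0}"

definition M_ideal_projection ::
    "'a::complex_normed_vector set \<Rightarrow> ('a dual \<Rightarrow> 'a dual) \<Rightarrow> bool"
  where "M_ideal_projection J P \<longleftrightarrow>
    Vector_Spaces.linear scaleC scaleC P \<and> P \<circ> P = P \<and>
    {f. P f = 0} = annihilator J \<and>
    (\<forall>f. norm f = norm (P f) + norm (f - P f))"

definition M_ideal :: "'a::complex_banach set \<Rightarrow> bool"
  where "M_ideal J \<longleftrightarrow>
    module.subspace scaleC J \<and> closed J \<and> (\<exists>P. M_ideal_projection J P)"

lemma M_ideal_projection_unique:
  assumes P: "M_ideal_projection J P" and Q: "M_ideal_projection J Q"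
  shows "P = Q"
proof
  fix f
  have diff: "R (g - h) = R g - R h" if "M_ideal_projection J R" for R g h
  proof -
    have "module_hom scaleC scaleC R"
      using that by (simp add: M_ideal_projection_def module_hom_iff_linear)
    then show ?thesis by (rule module_hom.diff)
  qed
  have idem: "R (R g) = R g" if "M_ideal_projection J R" for R g
  proof -
    have "R \<circ> R = R" using that unfolding M_ideal_projection_def by blast
    then show ?thesis by (metis comp_apply)
  qed
  have swap: "R (S g) = R g" if R: "M_ideal_projection J R" and S: "M_ideal_projection J S" for R S g
  proof -
    have "S (g - S g) = 0" unfolding diff[OF S] idem[OF S] by simp
    then have "R (g - S g) = 0" using R S unfolding M_ideal_projection_def by blast
    then show ?thesis unfolding diff[OF R] by simp
  qed
  have "norm (P f) = norm (Q (P f)) + norm (P f - Q (P f))"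
    using Q unfolding M_ideal_projection_def by blast
  moreover have "norm (Q f) = norm (P (Q f)) + norm (Q f - P (Q f))"
    using P unfolding M_ideal_projection_def by blast
  ultimately have "norm (P f - Q f) = 0"
    unfolding swap[OF P Q] swap[OF Q P] norm_minus_commute[of "Q f"] by linarith
  then show "P f = Q f" by simp
qed

text \<open>\<open>J\<^sup>*\<close> regarded as a subspace of \<open>E\<^sup>*\<close>: the range of the projection, which is unique by
  \<open>M_ideal_projection_unique\<close>.\<close>

definition M_ideal_dual :: "'a::complex_normed_vector set \<Rightarrow> 'a dual set"
  where "M_ideal_dual J = range (THE P. M_ideal_projection J P)"

lemma M_ideal_dual_eq: "M_ideal_projection J P \<Longrightarrow> M_ideal_dual J = range P"
  unfolding M_ideal_dual_def
  by (subst the_equality[of _ P]) (blast intro: M_ideal_projection_unique)+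

end

theory Submission
  imports Defs
begin

text \<open>If \<open>f\<close> supports \<open>A\<close> and \<open>P\<close> is the \<open>M\<close>-projection, then \<open>f - P f\<close> annihilates \<open>J\<close>, so
  \<open>d(A, J) < 1\<close> and \<open>\<parallel>f\<parallel> = \<parallel>P f\<parallel> + \<parallel>f - P f\<parallel>\<close> force \<open>f = P f\<close>. The support functionals form a weak-star
  compact face of the dual unit ball, and by Krein--Milman only their extreme points matter. The unit
  ball is the weak-star closed convex hull of the functionals \<open>x \<otimes> y\<close>, so by Milman's theorem an
  extreme point \<open>f\<close> is a weak-star limit of such functionals. On compact operators \<open>(x, y) \<mapsto> x (T\<^sup>* y)\<close>
  is jointly weak-star continuous on the product of the unit balls; hence \<open>f = x \<otimes> y\<close> on \<open>J\<close> for some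
  \<open>x\<close>, \<open>y\<close>, and therefore everywhere, because \<open>f\<close> is the only norm-preserving extension of its
  restriction to \<open>J\<close>.\<close>

section \<open>The weak-star topology\<close>

lemma scaleR_cblinfun_apply: "cblinfun_apply (r *\<^sub>R T) x = r *\<^sub>R T x"
  unfolding scaleR_cblinfun_def scaleC_cblinfun.rep_eq by (rule scaleC_of_real)

lemmas cblinfun_apply_simps = zero_cblinfun.rep_eq plus_cblinfun.rep_eq minus_cblinfun.rep_eq
  uminus_cblinfun.rep_eq scaleC_cblinfun.rep_eq scaleR_cblinfun_apply

lemmas cblinfun_linear_simps = linear_simps[OF bounded_linear_cblinfun_apply]
  bounded_clinear_scaleC[OF bounded_clinear_cblinfun_apply]

lemma Re_cblinfun_scaleC_ii: "Re (cblinfun_apply f (\<i> *\<^sub>C x)) = - Im (f x)"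
  for f :: "'a::complex_normed_vector dual"
  by (simp add: cblinfun_linear_simps scaleC_complex_def)

text \<open>Complex linearity gives Im (f x) = - Re (f (i x)), so real parts carry everything. This
  is why separation and faces are expressed below by real parts alone.\<close>

lemma dual_eqI_Re:
  fixes f g :: "'a::complex_normed_vector dual"
  assumes "\<And>x. Re (f x) = Re (g x)"
  shows "f = g"
proof (rule cblinfun_eqI)
  show "f x = g x" for x
    using assms[of x] assms[of "\<i> *\<^sub>C x"] by (simp add: Re_cblinfun_scaleC_ii complex_eq_iff)
qed

lemma topspace_weak_star [simp]: "topspace weak_star = UNIV"
  by (simp add: weak_star_def topspace_pullback_topology)

lemma continuous_map_weak_star_apply:
  "continuous_map weak_star euclidean (\<lambda>f. cblinfun_apply f x)"
proof -
  have "continuous_map euclidean euclidean (\<lambda>\<phi> :: 'a \<Rightarrow> complex. \<phi> x)"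
    using continuous_map_product_projection[of x UNIV "\<lambda>_. euclidean"]
    by (simp only: euclidean_product_topology) simp
  from continuous_map_pullback[OF this, of UNIV cblinfun_apply] show ?thesis
    by (simp add: weak_star_def comp_def)
qed

lemma continuous_map_weak_star_Re:
  "continuous_map weak_star euclideanreal (\<lambda>f. Re (cblinfun_apply f x))"
  using continuous_map_weak_star_apply[of x] by (simp add: continuous_map_atin tendsto_Re)

text \<open>The imaginary coordinate at \<open>x\<close> is minus the real coordinate at i x, so
  real coordinates suffice.\<close>

lemma continuous_map_into_weak_star:
  assumes "\<And>x. continuous_map X euclideanreal (\<lambda>z. Re (cblinfun_apply (h z) x))"
  shows "continuous_map X weak_star h"
proof -
  have "continuous_map X euclidean (\<lambda>z. cblinfun_apply (h z) x)" for x
  proof -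
    have "continuous_map X euclideanreal (\<lambda>z. - Re (cblinfun_apply (h z) (\<i> *\<^sub>C x)))"
      using assms continuous_map_minus by blast
    with assms[of x] show ?thesis
      by (simp add: Re_cblinfun_scaleC_ii continuous_map_atin tendsto_complex_iff)
  qed
  then have "continuous_map X euclidean (\<lambda>z. cblinfun_apply (h z))"
    unfolding euclidean_product_topology[symmetric] by (simp add: continuous_map_componentwise_UNIV)
  then show ?thesis
    unfolding weak_star_def by (intro continuous_map_pullback') (auto simp: comp_def)
qed

lemma Hausdorff_space_functions: "Hausdorff_space (euclidean :: ('a \<Rightarrow> 'b::metric_space) topology)"
  unfolding euclidean_product_topology[symmetric] by (simp add: Hausdorff_space_product_topology)

lemma Hausdorff_weak_star: "Hausdorff_space (weak_star :: 'a::complex_normed_vector dual topology)"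
proof -
  have "continuous_map weak_star euclidean (cblinfun_apply :: 'a dual \<Rightarrow> _)"
    unfolding euclidean_product_topology[symmetric]
    by (simp add: continuous_map_componentwise_UNIV continuous_map_weak_star_apply)
  moreover have "inj (cblinfun_apply :: 'a dual \<Rightarrow> _)"
    by (simp add: inj_on_def cblinfun_apply_inject)
  ultimately show ?thesis
    using Hausdorff_space_functions Hausdorff_space_injective_preimage by (metis topspace_weak_star)
qed

text \<open>By Tychonoff's theorem: the ball is a continuous image of a closed subset of a product
  of discs.\<close>

theorem Banach_Alaoglu: "compactin weak_star (cball (0 :: 'a::complex_normed_vector dual) 1)"
proof -
  define L :: "('a \<Rightarrow> complex) set" where
    "L = Pi\<^sub>E UNIV (\<lambda>x. cball 0 (norm x)) \<inter>
      ((\<Inter>x. \<Inter>y. {\<phi>. \<phi> (x + y) = \<phi> x + \<phi> y}) \<inter> (\<Inter>c. \<Inter>x. {\<phi>. \<phi> (c *\<^sub>C x) = c * \<phi> x}))"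
  have "compactin (product_topology (\<lambda>_. euclidean) UNIV)
      (Pi\<^sub>E UNIV (\<lambda>x::'a. cball (0::complex) (norm x)))"
    by (simp add: compactin_PiE)
  then have "compact (Pi\<^sub>E UNIV (\<lambda>x::'a. cball (0::complex) (norm x)))"
    by (simp add: euclidean_product_topology)
  moreover have "closed {\<phi>. \<phi> (x + y) = \<phi> x + (\<phi> y :: complex)}" for x y :: 'a
    by (intro closed_Collect_eq continuous_intros continuous_on_product_coordinates)
  moreover have "closed {\<phi>. \<phi> (c *\<^sub>C x) = c * (\<phi> x :: complex)}" for x :: 'a and c
    by (intro closed_Collect_eq continuous_intros continuous_on_product_coordinates)
  ultimately have "compact L"
    unfolding L_def by (intro compact_Int_closed closed_Int closed_INT) auto
  have bc: "bounded_clinear \<phi>" if "\<phi> \<in> L" for \<phi>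
    using that unfolding L_def
    by (intro bounded_clinearI[where K = 1]) (auto simp: scaleC_complex_def PiE_def Pi_def)
  have "continuous_map (subtopology euclidean L) weak_star CBlinfun"
  proof (rule continuous_map_into_weak_star)
    fix x
    have "continuous_on L (\<lambda>\<phi>. Re (\<phi> x))"
      by (intro continuous_on_Re continuous_on_subset[OF continuous_on_product_coordinates]) auto
    then show "continuous_map (subtopology euclidean L) euclideanreal (\<lambda>\<phi>. Re (CBlinfun \<phi> x))"
      by (simp add: bc CBlinfun_inverse cong: continuous_on_cong)
  qed
  moreover have "compactin (subtopology euclidean L) L"
    using \<open>compact L\<close> by (simp add: compactin_subtopology)
  ultimately have "compactin weak_star (CBlinfun ` L)"
    by (rule image_compactin[rotated])
  also have "CBlinfun ` L = cball 0 1"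
  proof (intro equalityI subsetI)
    fix f :: "'a dual"
    assume "f \<in> CBlinfun ` L"
    then obtain \<phi> where \<phi>: "\<phi> \<in> L" "f = CBlinfun \<phi>" by blast
    then have "cblinfun_apply f = \<phi>" using bc by (simp add: CBlinfun_inverse)
    with \<phi> show "f \<in> cball 0 1"
      by (auto simp: L_def PiE_def Pi_def intro!: norm_cblinfun_bound)
  next
    fix f :: "'a dual"
    assume f: "f \<in> cball 0 1"
    have "norm (f x) \<le> norm x" for x
    proof -
      have "norm (f x) \<le> norm f * norm x" by (rule norm_cblinfun)
      also have "\<dots> \<le> 1 * norm x" using f by (intro mult_right_mono) auto
      finally show ?thesis by simp
    qed
    then have "cblinfun_apply f \<in> L"
      by (auto simp: L_def PiE_def Pi_def cblinfun_linear_simps scaleC_complex_def)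
    then show "f \<in> CBlinfun ` L"
      by (metis cblinfun_apply_inverse imageI)
  qed
  finally show ?thesis .
qed

section \<open>Separation from weak-star compact convex sets\<close>

lemma compactin_INT_eq_empty:
  assumes "compactin X C" "\<And>i. closedin X (H i)" "C \<inter> (\<Inter>i. H i) = {}"
  shows "\<exists>F. finite F \<and> C \<inter> (\<Inter>i\<in>F. H i) = {}"
proof (rule ccontr)
  assume neg: "\<not> ?thesis"
  have "C \<inter> \<Inter> \<F> \<noteq> {}" if \<F>: "finite \<F>" "\<F> \<subseteq> range H" for \<F>
  proof -
    obtain F where "finite F" "\<F> = H ` F"
      using finite_subset_image[OF \<F>] by blast
    with neg show ?thesis by blast
  qed
  then have "C \<inter> \<Inter> (range H) \<noteq> {}"
    using assms(1,2) by (simp add: compactin_fip)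
  with assms(3) show False by blast
qed

text \<open>No Hahn--Banach argument is needed: by compactness finitely many points \<open>x\<close> already witness
  \<open>f \<notin> C\<close>, and the least-squares projection of \<open>f\<close> onto \<open>C\<close> with respect to these coordinates
  gives the separating vector.\<close>

lemma weak_star_separation:
  fixes f :: "'a::complex_normed_vector dual"
  assumes C: "compactin weak_star C" "convex C" and f: "f \<notin> C"
  shows "\<exists>x c. Re (f x) < c \<and> (\<forall>g\<in>C. c \<le> Re (g x))"
proof (cases "C = {}")
  case True
  then show ?thesis by (auto intro: lt_ex gt_ex)
next
  case False
  let ?H = "\<lambda>x. {g :: 'a dual. Re (g x) = Re (f x)}"
  have closed: "closedin weak_star (?H x)" for x
    using closedin_continuous_map_preimage[OF continuous_map_weak_star_Re, of "{Re (f x)}" x] by simp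
  have empty: "C \<inter> \<Inter> (range ?H) = {}"
  proof -
    have "g = f" if "g \<in> \<Inter> (range ?H)" for g
      using that by (intro dual_eqI_Re) auto
    with f show ?thesis by blast
  qed
  obtain F where F: "finite F" "C \<inter> (\<Inter>x\<in>F. ?H x) = {}"
    using compactin_INT_eq_empty[OF C(1), of ?H] closed empty by blast
  let ?N = "\<lambda>g :: 'a dual. \<Sum>x\<in>F. (Re (g x) - Re (f x))\<^sup>2"
  have "continuous_map weak_star euclideanreal ?N"
    using continuous_map_weak_star_Re F(1)
    by (intro continuous_map_sum continuous_map_real_pow continuous_map_diff) auto
  then have "compact (?N ` C)"
    using C(1) image_compactin compactin_euclidean_iff by blast
  then obtain g0 where g0: "g0 \<in> C" "\<And>g. g \<in> C \<Longrightarrow> ?N g0 \<le> ?N g"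
    using compact_attains_inf[of "?N ` C"] False by auto
  define d where "d x = Re (g0 x) - Re (f x)" for x
  define D where "D = (\<Sum>x\<in>F. (d x)\<^sup>2)"
  have "D > 0"
  proof -
    obtain x where "x \<in> F" "d x \<noteq> 0" using F(2) g0(1) by (auto simp: d_def)
    then show ?thesis unfolding D_def using F(1) by (intro sum_pos2[of _ x]) auto
  qed
  \<comment> \<open>The variational inequality of the nearest point \<open>g0\<close>: moving from
    \<open>g0\<close> towards \<open>g\<close> inside \<open>C\<close> cannot decrease
    \<open>?N\<close>.\<close>
  have ineq: "(\<Sum>x\<in>F. d x * (Re (g x) - Re (g0 x))) \<ge> 0" if g: "g \<in> C" for g
  proof (rule ccontr)
    define e where "e x = Re (g x) - Re (g0 x)" for x
    define P where "P = (\<Sum>x\<in>F. d x * e x)"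
    define Q where "Q = (\<Sum>x\<in>F. (e x)\<^sup>2)"
    assume "\<not> ?thesis"
    then have "P < 0" by (simp add: P_def e_def)
    have "Q \<ge> 0" unfolding Q_def by (intro sum_nonneg) auto
    have le: "0 \<le> 2 * t * P + t\<^sup>2 * Q" if t: "0 \<le> t" "t \<le> 1" for t
    proof -
      have "(1 - t) *\<^sub>R g0 + t *\<^sub>R g \<in> C"
        using C(2) g g0(1) t by (simp add: convex_alt)
      from g0(2)[OF this] have "D \<le> (\<Sum>x\<in>F. (d x + t * e x)\<^sup>2)"
        by (simp add: D_def d_def e_def cblinfun_apply_simps algebra_simps)
      also have "\<dots> = D + (2 * t * P + t\<^sup>2 * Q)"
        by (simp add: D_def P_def Q_def power2_sum sum.distrib sum_distrib_left power_mult_distrib mult_ac)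
      finally show ?thesis by simp
    qed
    \<comment> \<open>Small enough that the quadratic term \<open>t\<^sup>2 * Q\<close> cannot
      compensate the negative linear term \<open>2 * t * P\<close>; the 1 in \<open>Q + 1\<close>
      excludes division by zero.\<close>
    define t where "t = min 1 (- P / (Q + 1))"
    have t: "0 < t" "t \<le> 1" using \<open>P < 0\<close> \<open>Q \<ge> 0\<close> by (auto simp: t_def divide_neg_pos)
    have "t * (Q + 1) \<le> - P"
      using \<open>Q \<ge> 0\<close> by (simp add: t_def flip: pos_le_divide_eq)
    then have "t * Q < - 2 * P" using t \<open>P < 0\<close> by (simp add: algebra_simps)
    then have "t * (2 * P + t * Q) < 0" using t by (intro mult_pos_neg) auto
    with le[of t] t show False by (simp add: power2_eq_square algebra_simps)
  qed
  \<comment> \<open>Evaluation at \<open>z\<close> is the inner product with \<open>d\<close> in the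
    coordinates \<open>F\<close>; the gap between \<open>f\<close> and \<open>g0\<close> at
    \<open>z\<close> is exactly \<open>D\<close>.\<close>
  define z where "z = (\<Sum>x\<in>F. d x *\<^sub>R x)"
  have z: "Re (h z) = (\<Sum>x\<in>F. d x * Re (h x))" for h :: "'a dual"
    by (simp add: z_def linear_sum[OF bounded_linear.linear[OF bounded_linear_cblinfun_apply]]
        cblinfun_linear_simps)
  show ?thesis
  proof (intro exI conjI ballI)
    show "Re (f z) < Re (f z) + D" using \<open>D > 0\<close> by simp
    show "Re (f z) + D \<le> Re (g z)" if "g \<in> C" for g
    proof -
      have "Re (g z) - Re (f z) - D = (\<Sum>x\<in>F. d x * (Re (g x) - Re (g0 x)))"
        by (simp add: z D_def d_def power2_eq_square algebra_simps sum_subtractf sum.distrib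
            sum_distrib_left)
      with ineq[OF that] show ?thesis by simp
    qed
  qed
qed

text \<open>A convex combination with fixed weights is jointly weak-star continuous, and the closure
  of \<open>S \<times> S\<close> is the product of the closures.\<close>

lemma convex_closure_of_weak_star:
  fixes S :: "'a::complex_normed_vector dual set"
  assumes "convex S"
  shows "convex (weak_star closure_of S)"
proof (unfold convex_alt, intro ballI allI impI)
  fix f g and t :: real
  assume fg: "f \<in> weak_star closure_of S" "g \<in> weak_star closure_of S" and t: "0 \<le> t \<and> t \<le> 1"
  let ?m = "\<lambda>p :: 'a dual \<times> 'a dual. (1 - t) *\<^sub>R fst p + t *\<^sub>R snd p"
  have "continuous_map (prod_topology weak_star weak_star) weak_star ?m"
  proof (rule continuous_map_into_weak_star)
    fix x :: 'a
    have "continuous_map (prod_topology weak_star weak_star) euclideanreal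
        (\<lambda>p. (1 - t) * Re (cblinfun_apply (fst p) x) + t * Re (cblinfun_apply (snd p) x))"
      by (intro continuous_map_add continuous_map_real_mult_left
          continuous_map_compose[OF continuous_map_fst continuous_map_weak_star_Re, unfolded comp_def]
          continuous_map_compose[OF continuous_map_snd continuous_map_weak_star_Re, unfolded comp_def])
    then show "continuous_map (prod_topology weak_star weak_star) euclideanreal (\<lambda>p. Re (?m p x))"
      by (simp add: cblinfun_apply_simps)
  qed
  then have "?m ` (prod_topology weak_star weak_star closure_of (S \<times> S))
      \<subseteq> weak_star closure_of (?m ` (S \<times> S))"
    by (rule continuous_map_image_closure_subset)
  moreover have "?m ` (S \<times> S) \<subseteq> S"
    using assms t by (auto simp: convex_alt)
  ultimately have "?m ` (prod_topology weak_star weak_star closure_of (S \<times> S)) \<subseteq> weak_star closure_of S"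
    using closure_of_mono by blast
  moreover have "(f, g) \<in> prod_topology weak_star weak_star closure_of (S \<times> S)"
    using fg by (simp add: closure_of_Times)
  ultimately show "(1 - t) *\<^sub>R f + t *\<^sub>R g \<in> weak_star closure_of S"
    by force
qed

section \<open>Extreme points of weak-star compact convex sets\<close>

text \<open>A segment in \<open>S\<close> is mapped to a segment in \<open>S'\<close> or collapses
  to a point. The collapse is a separate case because \<open>open_segment a a\<close> is
  empty.\<close>

lemma face_of_linear_vimage:
  assumes "linear h" "convex S" "h ` S \<subseteq> S'" "F face_of S'"
  shows "{x \<in> S. h x \<in> F} face_of S"
  unfolding face_of_def
proof (intro conjI ballI impI)
  have "convex (S \<inter> h -` F)"
    using assms by (intro convex_Int convex_linear_vimage) (auto simp: face_of_def)
  then show "convex {x \<in> S. h x \<in> F}" by (simp add: Int_def)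
next
  fix a b x
  assume ab: "a \<in> S" "b \<in> S" and x: "x \<in> {x \<in> S. h x \<in> F}" "x \<in> open_segment a b"
  then obtain u where u: "0 < u" "u < 1" "x = (1 - u) *\<^sub>R a + u *\<^sub>R b"
    by (auto simp: in_segment)
  then have hx: "h x = (1 - u) *\<^sub>R h a + u *\<^sub>R h b"
    using assms(1) by (simp add: linear_add linear_scale)
  have "h a \<in> F \<and> h b \<in> F"
  proof (cases "h a = h b")
    case True
    then have "h x = h a" using hx by (simp add: algebra_simps)
    with True x show ?thesis by simp
  next
    case False
    with u hx have "h x \<in> open_segment (h a) (h b)" by (auto simp: in_segment)
    moreover have "h a \<in> S'" "h b \<in> S'" using ab assms(3) by auto
    ultimately show ?thesis using assms(4) x face_ofD by blast
  qed
  with ab show "a \<in> {x \<in> S. h x \<in> F}" "b \<in> {x \<in> S. h x \<in> F}" by auto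
qed auto

lemma linear_Re_cblinfun_apply: "linear (\<lambda>f :: 'a::complex_normed_vector dual. Re (cblinfun_apply f x))"
  by (rule linearI) (simp_all add: cblinfun_apply_simps)

lemma face_of_Re_minimum:
  fixes C :: "'a::complex_normed_vector dual set"
  assumes "convex C" "\<And>g. g \<in> C \<Longrightarrow> m \<le> Re (g x)"
  shows "{g \<in> C. Re (g x) = m} face_of C"
proof -
  have "{m} face_of {m..}"
    unfolding face_of_singleton extreme_point_of_def by (auto simp: open_segment_eq_real_ivl)
  then show ?thesis
    using face_of_linear_vimage[OF linear_Re_cblinfun_apply assms(1), of x "{m..}" "{m}"] assms(2)
    by auto
qed

lemma closedin_weak_star_Re_eq: "closedin weak_star {f. Re (cblinfun_apply f x) = m}"
  using closedin_continuous_map_preimage[OF continuous_map_weak_star_Re, of "{m}" x] by simp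

lemma closedin_weak_star_Re_ge: "closedin weak_star {f. m \<le> Re (cblinfun_apply f x)}"
  using closedin_continuous_map_preimage[OF continuous_map_weak_star_Re, of "{m..}" x] by simp

lemma closedin_weak_star_Re_le: "closedin weak_star {f. Re (cblinfun_apply f x) \<le> m}"
  using closedin_continuous_map_preimage[OF continuous_map_weak_star_Re, of "{..m}" x] by simp

lemma weak_star_attains_min_Re:
  assumes "compactin weak_star C" "C \<noteq> {}"
  obtains g where "g \<in> C" "\<And>h. h \<in> C \<Longrightarrow> Re (cblinfun_apply g x) \<le> Re (cblinfun_apply h x)"
proof -
  have "compact ((\<lambda>f. Re (cblinfun_apply f x)) ` C)"
    using assms(1) continuous_map_weak_star_Re image_compactin compactin_euclidean_iff by blast
  from compact_attains_inf[OF this] assms(2) that show ?thesis by auto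
qed

text \<open>Zorn's lemma yields a minimal nonempty closed face. Minimality makes every real part
  constant on it, so it is a single point.\<close>

lemma extreme_point_exists_weak_star:
  fixes C :: "'a::complex_normed_vector dual set"
  assumes C: "compactin weak_star C" "convex C" "C \<noteq> {}"
  shows "\<exists>e. e extreme_point_of C"
proof -
  define A where "A = {F. F face_of C \<and> F \<noteq> {} \<and> closedin weak_star F}"
  have "\<exists>F\<in>A. \<forall>G\<in>A. G \<subseteq> F \<longrightarrow> G = F"
  proof (rule predicate_Zorn)
    show "partial_order_on A (relation_of (\<lambda>F G. G \<subseteq> F) A)"
      by (rule partial_order_on_relation_ofI) auto
  next
    fix \<C>
    assume ch: "\<C> \<in> Chains (relation_of (\<lambda>F G. G \<subseteq> F) A)"
    then have sub: "\<C> \<subseteq> A" and lin: "\<And>F G. F \<in> \<C> \<Longrightarrow> G \<in> \<C> \<Longrightarrow> F \<subseteq> G \<or> G \<subseteq> F"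
      by (auto simp: Chains_def relation_of_def)
    show "\<exists>U\<in>A. \<forall>F\<in>\<C>. U \<subseteq> F"
    proof (cases "\<C> = {}")
      case True
      have "C \<in> A"
        using C by (simp add: A_def face_of_refl compactin_imp_closedin[OF Hausdorff_weak_star])
      with True show ?thesis by auto
    next
      case False
      \<comment> \<open>A chain is closed under finite nonempty intersections, so the finite
        intersection property reduces to nonemptiness of the members.\<close>
      have fin: "\<Inter>\<F> \<in> \<C>" if "finite \<F>" "\<F> \<noteq> {}" "\<F> \<subseteq> \<C>" for \<F>
        using that
      proof (induction \<F> rule: finite_ne_induct)
        case (insert F \<F>)
        then have "F \<inter> \<Inter>\<F> = F \<or> F \<inter> \<Inter>\<F> = \<Inter>\<F>"
          using lin[of F "\<Inter>\<F>"] by auto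
        with insert show ?case by auto
      qed auto
      have "C \<inter> \<Inter>\<F> \<noteq> {}" if \<F>: "finite \<F>" "\<F> \<subseteq> \<C>" for \<F>
      proof (cases "\<F> = {}")
        case False
        then have "\<Inter>\<F> \<in> A" using fin \<F> sub by blast
        then show ?thesis by (auto simp: A_def dest!: face_of_imp_subset)
      qed (use C in auto)
      moreover have "\<And>F. F \<in> \<C> \<Longrightarrow> closedin weak_star F" using sub by (auto simp: A_def)
      ultimately have "C \<inter> \<Inter>\<C> \<noteq> {}"
        using C(1) by (simp add: compactin_fip)
      moreover have "\<Inter>\<C> face_of C"
        using False sub by (intro face_of_Inter) (auto simp: A_def)
      moreover have "closedin weak_star (\<Inter>\<C>)"
        using False sub by (intro closedin_Inter) (auto simp: A_def)
      ultimately have "\<Inter>\<C> \<in> A" by (auto simp: A_def)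
      then show ?thesis by blast
    qed
  qed
  then obtain F where F: "F face_of C" "F \<noteq> {}" "closedin weak_star F"
    and min: "\<And>G. G \<in> A \<Longrightarrow> G \<subseteq> F \<Longrightarrow> G = F"
    by (auto simp: A_def)
  have comp: "compactin weak_star F" and conv: "convex F"
    using F closed_compactin[OF C(1)] by (auto simp: face_of_def)
  \<comment> \<open>The part of \<open>F\<close> on which the real part at \<open>x\<close> is
    minimal is again a closed face of \<open>C\<close>; by minimality it is all of
    \<open>F\<close>.\<close>
  have const: "Re (g x) = Re (h x)" if "g \<in> F" "h \<in> F" for g h x
  proof -
    obtain k where k: "k \<in> F" "\<And>h. h \<in> F \<Longrightarrow> Re (k x) \<le> Re (h x)"
      using weak_star_attains_min_Re[OF comp F(2)] by blast
    let ?G = "{g \<in> F. Re (g x) = Re (k x)}"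
    have "?G face_of C"
      using face_of_Re_minimum[OF conv k(2)] F(1) face_of_trans by blast
    moreover have "closedin weak_star ?G"
      using closedin_Int[OF F(3) closedin_weak_star_Re_eq[of x "Re (k x)"]] by (simp add: Int_def)
    ultimately have "?G = F"
      using k(1) by (intro min) (auto simp: A_def)
    with that show ?thesis by (metis (mono_tags, lifting) mem_Collect_eq)
  qed
  obtain e where "e \<in> F" using F(2) by blast
  then have "F = {e}" using const dual_eqI_Re by blast
  with F(1) show ?thesis by (auto simp: face_of_singleton)
qed

text \<open>If a vector \<open>x\<close> separates some \<open>f\<close> in \<open>K\<close> from
  the closed hull, then the face of \<open>K\<close> where the real part at \<open>x\<close> is
  minimal misses the hull as well; but that face contains an extreme point of
  \<open>K\<close>.\<close>

theorem Krein_Milman_weak_star: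
  fixes K :: "'a::complex_normed_vector dual set"
  assumes K: "compactin weak_star K" "convex K"
  shows "K = weak_star closure_of (convex hull {e. e extreme_point_of K})" (is "K = ?C")
proof
  have "convex hull {e. e extreme_point_of K} \<subseteq> K"
    using K(2) by (intro hull_minimal) (auto simp: extreme_point_of_def)
  then show sub: "?C \<subseteq> K"
    using K(1) by (intro closure_of_minimal compactin_imp_closedin[OF Hausdorff_weak_star])
  show "K \<subseteq> ?C"
  proof (rule ccontr)
    assume "\<not> K \<subseteq> ?C"
    then obtain f where f: "f \<in> K" "f \<notin> ?C" by blast
    have "compactin weak_star ?C"
      by (rule closed_compactin[OF K(1) sub]) simp
    from weak_star_separation[OF this convex_closure_of_weak_star[OF convex_convex_hull] f(2)]
    obtain x c where xc: "Re (f x) < c" "\<forall>g\<in>?C. c \<le> Re (g x)"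
      by blast
    obtain k where k: "k \<in> K" "\<And>h. h \<in> K \<Longrightarrow> Re (k x) \<le> Re (h x)"
      using weak_star_attains_min_Re[OF K(1)] f(1) by blast
    let ?G = "{g \<in> K. Re (g x) = Re (k x)}"
    have G: "?G face_of K" using face_of_Re_minimum[OF K(2) k(2)] .
    have "closedin weak_star ?G"
      using closedin_Int[OF compactin_imp_closedin[OF Hausdorff_weak_star K(1)]
          closedin_weak_star_Re_eq[of x "Re (k x)"]] by (simp add: Int_def)
    then have "compactin weak_star ?G" by (intro closed_compactin[OF K(1)]) auto
    moreover have "convex ?G" using G unfolding face_of_def by blast
    moreover have "?G \<noteq> {}" using k(1) by blast
    ultimately obtain e where e: "e extreme_point_of ?G"
      using extreme_point_exists_weak_star by blast
    then have "e extreme_point_of K" using extreme_point_of_face[OF G] by blast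
    then have "e \<in> ?C"
      by (intro subsetD[OF closure_of_subset] hull_inc) auto
    moreover have "Re (e x) \<le> Re (f x)" using e k(2)[OF f(1)] by (auto simp: extreme_point_of_def)
    ultimately show False using xc by fastforce
  qed
qed

section \<open>Milman's converse of the Krein-Milman theorem\<close>

text \<open>For weak-star compact \<open>S\<close> and \<open>T\<close> the right-hand side is a
  continuous image of a compact set, which makes the hull closed.\<close>

lemma convex_hull_Un_segments:
  assumes "convex S" "convex T" "S \<noteq> {}" "T \<noteq> {}"
  shows "convex hull (S \<union> T) = (\<lambda>(t, a, b). (1 - t) *\<^sub>R a + t *\<^sub>R b) ` ({0..1} \<times> (S \<times> T))"
    (is "_ = ?D")
proof
  have "convex hull (S \<union> T) = convex hull (\<Union>((\<lambda>i. if i then T else S) ` UNIV))"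
    by (simp add: UNIV_bool Un_commute)
  also have "\<dots> = {\<Sum>i\<in>UNIV. c i *\<^sub>R s i |c s. (\<forall>i\<in>UNIV. 0 \<le> c i) \<and> sum c UNIV = 1 \<and>
      (\<forall>i\<in>UNIV. s i \<in> (if i then T else S))}"
    by (rule convex_hull_finite_union) (use assms in auto)
  also have "\<dots> \<subseteq> ?D"
  proof clarify
    fix c :: "bool \<Rightarrow> real" and s :: "bool \<Rightarrow> 'a"
    assume c: "\<forall>i\<in>UNIV. 0 \<le> c i" "sum c UNIV = 1" and s: "\<forall>i\<in>UNIV. s i \<in> (if i then T else S)"
    from c have "c False = 1 - c True" "0 \<le> c True" "c True \<le> 1"
      by (auto simp: UNIV_bool intro: order_trans[of _ "c False + c True"])
    moreover have "s False \<in> S" "s True \<in> T" using s by (force split: if_splits)+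
    ultimately show "(\<Sum>i\<in>UNIV. c i *\<^sub>R s i) \<in> ?D"
      by (intro image_eqI[of _ _ "(c True, s False, s True)"]) (auto simp: UNIV_bool)
  qed
  finally show "convex hull (S \<union> T) \<subseteq> ?D" .
  have "(1 - t) *\<^sub>R a + t *\<^sub>R b \<in> convex hull (S \<union> T)"
    if "a \<in> S" "b \<in> T" "0 \<le> t" "t \<le> 1" for a b and t :: real
    using that convex_convex_hull[of "S \<union> T"] hull_inc[of _ "S \<union> T" convex]
    by (intro convexD_alt) auto
  then show "?D \<subseteq> convex hull (S \<union> T)" by auto
qed

text \<open>Both closed hulls are compact and convex, so the hull of their union is closed and
  contains \<open>f\<close>. Thus \<open>f\<close> lies on a segment between them, and extremality
  puts it at an endpoint.\<close>

lemma extreme_point_of_closure_hull_Un: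
  fixes K :: "'a::complex_normed_vector dual set"
  assumes f: "f extreme_point_of K" and K: "compactin weak_star K" "convex K"
    and AB: "A \<union> B \<subseteq> K" and fAB: "f \<in> weak_star closure_of (convex hull (A \<union> B))"
  shows "f \<in> weak_star closure_of (convex hull A) \<or> f \<in> weak_star closure_of (convex hull B)"
proof (cases "A = {} \<or> B = {}")
  case True
  then show ?thesis using fAB by auto
next
  case False
  define cc where "cc S = weak_star closure_of (convex hull S)" for S :: "'a dual set"
  have inc: "S \<subseteq> cc S" for S
    unfolding cc_def using hull_subset[of S convex] closure_of_subset[of "convex hull S" weak_star]
    by simp
  have conv: "convex (cc S)" for S
    unfolding cc_def by (intro convex_closure_of_weak_star convex_convex_hull)
  have ccK: "cc S \<subseteq> K" if "S \<subseteq> K" for S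
    unfolding cc_def using that K
    by (intro closure_of_minimal hull_minimal compactin_imp_closedin[OF Hausdorff_weak_star])
  have comp: "compactin weak_star (cc S)" if "S \<subseteq> K" for S
    by (rule closed_compactin[OF K(1) ccK[OF that]]) (simp add: cc_def)
  let ?m = "\<lambda>(t, a, b). (1 - t) *\<^sub>R a + t *\<^sub>R b :: 'a dual"
  let ?X = "prod_topology euclideanreal (prod_topology weak_star weak_star)
    :: (real \<times> 'a dual \<times> 'a dual) topology"
  have "continuous_map ?X weak_star ?m"
  proof (rule continuous_map_into_weak_star)
    fix x :: 'a
    have t: "continuous_map ?X euclideanreal fst" by (rule continuous_map_fst)
    have a: "continuous_map ?X euclideanreal (\<lambda>p. Re (cblinfun_apply (fst (snd p)) x))"
      using continuous_map_compose[OF continuous_map_compose[OF continuous_map_snd continuous_map_fst]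
          continuous_map_weak_star_Re] by (simp add: comp_def)
    have b: "continuous_map ?X euclideanreal (\<lambda>p. Re (cblinfun_apply (snd (snd p)) x))"
      using continuous_map_compose[OF continuous_map_compose[OF continuous_map_snd continuous_map_snd]
          continuous_map_weak_star_Re] by (simp add: comp_def)
    have "continuous_map ?X euclideanreal (\<lambda>p. (1 - fst p) * Re (cblinfun_apply (fst (snd p)) x)
        + fst p * Re (cblinfun_apply (snd (snd p)) x))"
      using t a b by (intro continuous_map_add continuous_map_real_mult continuous_map_diff) auto
    then show "continuous_map ?X euclideanreal (\<lambda>p. Re (cblinfun_apply (?m p) x))"
      by (simp add: case_prod_beta cblinfun_apply_simps)
  qed
  moreover have "compactin ?X ({0..1} \<times> (cc A \<times> cc B))"
    using AB comp by (simp add: compactin_Times)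
  ultimately have "compactin weak_star (?m ` ({0..1} \<times> (cc A \<times> cc B)))"
    by (rule image_compactin[rotated])
  also have "?m ` ({0..1} \<times> (cc A \<times> cc B)) = convex hull (cc A \<union> cc B)"
    using False inc[of A] inc[of B] by (intro convex_hull_Un_segments[symmetric] conv) auto
  finally have "closedin weak_star (convex hull (cc A \<union> cc B))"
    by (rule compactin_imp_closedin[OF Hausdorff_weak_star])
  moreover have "convex hull (A \<union> B) \<subseteq> convex hull (cc A \<union> cc B)"
    using inc[of A] inc[of B] by (intro hull_mono) auto
  ultimately have "f \<in> convex hull (cc A \<union> cc B)"
    using fAB closure_of_minimal by blast
  then have "f \<in> ?m ` ({0..1} \<times> (cc A \<times> cc B))"
    using False inc[of A] inc[of B] convex_hull_Un_segments[of "cc A" "cc B"] conv by auto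
  then obtain t a b where t: "0 \<le> t" "t \<le> 1" and ab: "a \<in> cc A" "b \<in> cc B"
    and feq: "f = (1 - t) *\<^sub>R a + t *\<^sub>R b"
    by auto
  have "a \<in> K" "b \<in> K" using ab ccK AB by auto
  then have "f \<notin> open_segment a b" using f by (simp add: extreme_point_of_def)
  moreover have "f \<in> open_segment a b" if "a \<noteq> b" "0 < t" "t < 1"
    unfolding in_segment using that feq by blast
  ultimately have "a = b \<or> t = 0 \<or> t = 1"
    using t by fastforce
  then have "f = a \<or> f = b"
    using feq by (auto simp: algebra_simps)
  with ab show ?thesis by (auto simp: cc_def)
qed

lemma extreme_point_of_closure_hull_UN:
  fixes K :: "'a::complex_normed_vector dual set"
  assumes "finite I" and f: "f extreme_point_of K" and K: "compactin weak_star K" "convex K"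
    and "(\<Union>i\<in>I. V i) \<subseteq> K" "f \<in> weak_star closure_of (convex hull (\<Union>i\<in>I. V i))"
  shows "\<exists>i\<in>I. f \<in> weak_star closure_of (convex hull (V i))"
  using assms(1,5,6)
proof (induction I rule: finite_induct)
  case (insert i I)
  then show ?case
    using extreme_point_of_closure_hull_Un[OF f K, of "V i" "\<Union>i\<in>I. V i"] by auto
qed simp

text \<open>If \<open>f\<close> is not in the closure of \<open>W\<close>, compactness covers \<open>W\<close> by finitely many sets
  \<open>{g. Re (g x) > Re (f x) + 1}\<close>; one of them has \<open>f\<close> in its closed convex hull, which is absurd.\<close>

theorem Milman_weak_star:
  fixes K :: "'a::complex_normed_vector dual set"
  assumes f: "f extreme_point_of K" and K: "compactin weak_star K" "convex K"
    and W: "W \<subseteq> K" "K \<subseteq> weak_star closure_of (convex hull W)"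
  shows "f \<in> weak_star closure_of W"
proof (rule ccontr)
  assume nf: "f \<notin> weak_star closure_of W"
  let ?H = "\<lambda>x. {g :: 'a dual. Re (g x) \<le> Re (f x) + 1}"
  have "weak_star closure_of W \<subseteq> K"
    using W K by (intro closure_of_minimal compactin_imp_closedin[OF Hausdorff_weak_star])
  then have "compactin weak_star (weak_star closure_of W)"
    by (intro closed_compactin[OF K(1)]) auto
  moreover have "weak_star closure_of W \<inter> (\<Inter>x. ?H x) = {}"
  proof -
    have "g = f" if g: "\<And>x. Re (g x) \<le> Re (f x) + 1" for g :: "'a dual"
    proof (rule dual_eqI_Re, rule ccontr)
      fix x
      define r where "r = Re (g x) - Re (f x)"
      assume "Re (g x) \<noteq> Re (f x)"
      then have "r \<noteq> 0" by (simp add: r_def)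
      \<comment> \<open>A nonzero difference \<open>r\<close> of the real parts at \<open>x\<close>
        becomes 2 at the vector \<open>(2 / r) *\<^sub>R x\<close>, above the permitted 1.\<close>
      then have "(2 / r) * r = 2" by simp
      moreover have "(2 / r) * r \<le> 1"
        using g[of "(2 / r) *\<^sub>R x"] by (simp add: cblinfun_linear_simps r_def right_diff_distrib)
      ultimately show False by simp
    qed
    with nf show ?thesis by blast
  qed
  ultimately have "\<exists>F. finite F \<and> weak_star closure_of W \<inter> (\<Inter>x\<in>F. ?H x) = {}"
    using closedin_weak_star_Re_le by (intro compactin_INT_eq_empty)
  then obtain F where F: "finite F" "weak_star closure_of W \<inter> (\<Inter>x\<in>F. ?H x) = {}"
    by blast
  let ?V = "\<lambda>x. {g \<in> W. Re (f x) + 1 < Re (g x)}"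
  have "W \<subseteq> weak_star closure_of W" by (rule closure_of_subset) simp
  with F(2) have "(\<Union>x\<in>F. ?V x) = W" by (force simp: not_le)
  then have V: "(\<Union>x\<in>F. ?V x) \<subseteq> K" "weak_star closure_of (convex hull (\<Union>x\<in>F. ?V x)) =
      weak_star closure_of (convex hull W)"
    using W(1) by simp_all
  have "f \<in> weak_star closure_of (convex hull W)"
    using f W(2) by (auto simp: extreme_point_of_def)
  then have "\<exists>x\<in>F. f \<in> weak_star closure_of (convex hull (?V x))"
    by (intro extreme_point_of_closure_hull_UN[OF F(1) f K V(1)]) (simp only: V(2))
  then obtain x where x: "f \<in> weak_star closure_of (convex hull (?V x))" by blast
  \<comment> \<open>Every \<open>g\<close> in \<open>?V x\<close> exceeds \<open>f\<close> by more
    than 1 at \<open>x\<close>; the closed half-space keeps a gap of 1 after hull and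
    closure.\<close>
  let ?S = "{g :: 'a dual. Re (f x) + 1 \<le> Re (g x)}"
  have "?S = (\<lambda>g :: 'a dual. Re (g x)) -` {Re (f x) + 1..}" by auto
  then have "convex ?S"
    using convex_linear_vimage[OF linear_Re_cblinfun_apply, of "{Re (f x) + 1..}" x] by simp
  then have "weak_star closure_of (convex hull (?V x)) \<subseteq> ?S"
    by (intro closure_of_minimal hull_minimal closedin_weak_star_Re_ge) auto
  with x show False by auto
qed

section \<open>Norming functionals\<close>

definition sublinear :: "('a::real_vector \<Rightarrow> real) \<Rightarrow> bool"
  where "sublinear p \<longleftrightarrow> (\<forall>x y. p (x + y) \<le> p x + p y) \<and> (\<forall>r x. 0 \<le> r \<longrightarrow> p (r *\<^sub>R x) = r * p x)"

lemma sublinear_add: "sublinear p \<Longrightarrow> p (x + y) \<le> p x + p y"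
  and sublinear_scaleR: "sublinear p \<Longrightarrow> 0 \<le> r \<Longrightarrow> p (r *\<^sub>R x) = r * p x"
  by (auto simp: sublinear_def)

lemma sublinear_zero: "sublinear p \<Longrightarrow> p 0 = 0"
  using sublinear_scaleR[of p 0 0] by simp

lemma sublinear_minus: "sublinear p \<Longrightarrow> - p (- x) \<le> p x"
  using sublinear_add[of p x "- x"] sublinear_zero[of p] by simp

text \<open>Shifting by \<open>w\<close> lowers \<open>p\<close> to a sublinear functional with value at most \<open>- p w\<close> at \<open>- w\<close>.\<close>

definition sublinear_shift :: "('a::real_vector \<Rightarrow> real) \<Rightarrow> 'a \<Rightarrow> 'a \<Rightarrow> real"
  where "sublinear_shift p w x = (INF t\<in>{0..}. p (x + t *\<^sub>R w) - t * p w)"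

text \<open>The lower bound \<open>- p (- x)\<close> makes the infimum finite. Subadditivity comes
  from adding the parameters \<open>s\<close> and \<open>t\<close>, homogeneity from replacing
  \<open>t\<close> by \<open>t / r\<close>.\<close>

lemma
  assumes p: "sublinear p"
  shows sublinear_sublinear_shift: "sublinear (sublinear_shift p w)"
    and sublinear_shift_le: "0 \<le> t \<Longrightarrow> sublinear_shift p w x \<le> p (x + t *\<^sub>R w) - t * p w"
proof -
  let ?q = "sublinear_shift p w"
  have lower: "- p (- x) \<le> p (x + t *\<^sub>R w) - t * p w" if "0 \<le> t" for x t
    using sublinear_add[OF p, of "x + t *\<^sub>R w" "- x"] sublinear_scaleR[OF p that, of w] by simp
  have upper: "?q x \<le> p (x + t *\<^sub>R w) - t * p w" if "0 \<le> t" for x t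
    unfolding sublinear_shift_def using lower that by (intro cINF_lower bdd_belowI2) auto
  then show "0 \<le> t \<Longrightarrow> ?q x \<le> p (x + t *\<^sub>R w) - t * p w" .
  have greatest: "c \<le> ?q x" if "\<And>t. 0 \<le> t \<Longrightarrow> c \<le> p (x + t *\<^sub>R w) - t * p w" for c x
    unfolding sublinear_shift_def using that by (intro cINF_greatest) auto
  have add: "?q (x + y) \<le> ?q x + ?q y" for x y
  proof -
    have "?q (x + y) - (p (y + s *\<^sub>R w) - s * p w) \<le> ?q x" if s: "0 \<le> s" for s
    proof (rule greatest)
      fix t :: real
      assume t: "0 \<le> t"
      have "?q (x + y) \<le> p ((x + t *\<^sub>R w) + (y + s *\<^sub>R w)) - (t + s) * p w"
        using upper[of "t + s" "x + y"] s t by (simp add: algebra_simps)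
      also have "\<dots> \<le> p (x + t *\<^sub>R w) + p (y + s *\<^sub>R w) - (t + s) * p w"
        using sublinear_add[OF p] by simp
      finally show "?q (x + y) - (p (y + s *\<^sub>R w) - s * p w) \<le> p (x + t *\<^sub>R w) - t * p w"
        by (simp add: algebra_simps)
    qed
    then have "?q (x + y) - ?q x \<le> ?q y"
      by (intro greatest) (simp add: algebra_simps)
    then show ?thesis by simp
  qed
  have pos: "r * ?q x \<le> ?q (r *\<^sub>R x)" if r: "0 < r" for r x
  proof (rule greatest)
    fix t :: real
    assume t: "0 \<le> t"
    have "r * ?q x \<le> r * (p (x + (t / r) *\<^sub>R w) - t / r * p w)"
      using r t by (intro mult_left_mono upper) auto
    also have "\<dots> = r * p (x + (t / r) *\<^sub>R w) - t * p w"
      using r by (simp add: right_diff_distrib)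
    also have "r * p (x + (t / r) *\<^sub>R w) = p (r *\<^sub>R x + t *\<^sub>R w)"
      using sublinear_scaleR[OF p, of r "x + (t / r) *\<^sub>R w"] r by (simp add: scaleR_add_right)
    finally show "r * ?q x \<le> p (r *\<^sub>R x + t *\<^sub>R w) - t * p w" .
  qed
  have "?q 0 = 0"
  proof (rule antisym)
    show "?q 0 \<le> 0" using upper[of 0 0] sublinear_zero[OF p] by simp
    show "0 \<le> ?q 0" by (rule greatest) (simp add: sublinear_scaleR[OF p])
  qed
  moreover have "?q (r *\<^sub>R x) = r * ?q x" if r: "0 < r" for r x
  proof (rule antisym)
    have "inverse r * ?q (r *\<^sub>R x) \<le> ?q x"
      using pos[of "inverse r" "r *\<^sub>R x"] r by simp
    then show "?q (r *\<^sub>R x) \<le> r * ?q x"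
      using r by (simp add: field_simps)
  qed (rule pos[OF r])
  ultimately have "?q (r *\<^sub>R x) = r * ?q x" if "0 \<le> r" for r x
    using that by (cases "r = 0") auto
  with add show "sublinear ?q" by (simp add: sublinear_def)
qed

text \<open>The common upper bound \<open>P\<close> bounds every member below by
  \<open>- P (- x)\<close>. For subadditivity, two members are comparable, and the smaller one
  bounds both values.\<close>

lemma sublinear_INF_chain:
  assumes "\<C> \<noteq> {}" and sub: "\<And>p. p \<in> \<C> \<Longrightarrow> sublinear p" and le: "\<And>p x. p \<in> \<C> \<Longrightarrow> p x \<le> P x"
    and chain: "\<And>p q. p \<in> \<C> \<Longrightarrow> q \<in> \<C> \<Longrightarrow> p \<le> q \<or> q \<le> p"
  shows "sublinear (\<lambda>x. INF p\<in>\<C>. p x)" and "p \<in> \<C> \<Longrightarrow> (INF p\<in>\<C>. p x) \<le> p x"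
proof -
  let ?q = "\<lambda>x. INF p\<in>\<C>. p x"
  have "- P (- x) \<le> p x" if "p \<in> \<C>" for p x
    using sublinear_minus[OF sub[OF that], of x] le[OF that, of "- x"] by simp
  then have bdd: "bdd_below ((\<lambda>p. p x) ` \<C>)" for x by (intro bdd_belowI2)
  have lower: "?q x \<le> p x" if "p \<in> \<C>" for p x
    using bdd that by (rule cINF_lower)
  then show "p \<in> \<C> \<Longrightarrow> ?q x \<le> p x" .
  have greatest: "c \<le> ?q x" if "\<And>p. p \<in> \<C> \<Longrightarrow> c \<le> p x" for c x
    using assms(1) that by (rule cINF_greatest)
  have "?q (x + y) \<le> ?q x + ?q y" for x y
  proof -
    have "?q (x + y) - p y \<le> ?q x" if p: "p \<in> \<C>" for p
    proof (rule greatest)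
      fix p'
      assume p': "p' \<in> \<C>"
      obtain r where r: "r \<in> \<C>" "r \<le> p" "r \<le> p'"
        using chain[OF p p'] p p' by auto
      have "?q (x + y) \<le> r (x + y)" using lower r by blast
      also have "\<dots> \<le> r x + r y" using sublinear_add sub r by blast
      also have "\<dots> \<le> p' x + p y" using r by (intro add_mono) (auto simp: le_fun_def)
      finally show "?q (x + y) - p y \<le> p' x" by simp
    qed
    then have "?q (x + y) - ?q x \<le> ?q y" by (intro greatest) (simp add: algebra_simps)
    then show ?thesis by simp
  qed
  moreover have "?q (r *\<^sub>R x) = r * ?q x" if r: "0 \<le> r" for r x
  proof (cases "r = 0")
    case True
    have "?q 0 = 0"
      using assms(1) sub by (simp add: sublinear_zero cong: INF_cong)
    with True show ?thesis by simp
  next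
    case False
    then have r: "0 < r" using r by simp
    show ?thesis
    proof (rule antisym)
      have "?q (r *\<^sub>R x) / r \<le> ?q x"
      proof (rule greatest)
        fix p
        assume "p \<in> \<C>"
        then have "?q (r *\<^sub>R x) \<le> r * p x"
          using lower[of p "r *\<^sub>R x"] sublinear_scaleR[OF sub, of p r x] r by simp
        then show "?q (r *\<^sub>R x) / r \<le> p x" using r by (simp add: field_simps)
      qed
      then show "?q (r *\<^sub>R x) \<le> r * ?q x" using r by (simp add: field_simps)
      show "r * ?q x \<le> ?q (r *\<^sub>R x)"
      proof (rule greatest)
        fix p
        assume "p \<in> \<C>"
        then show "r * ?q x \<le> p (r *\<^sub>R x)"
          using lower[of p x] sublinear_scaleR[OF sub, of p r x] r by simp
      qed
    qed
  qed
  ultimately show "sublinear ?q" by (simp add: sublinear_def)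
qed

text \<open>A minimal sublinear functional \<open>q\<close> equals each of its shifts, which forces
  \<open>q (x + w) \<ge> q x + q w\<close>; so it is linear.\<close>

theorem linear_below_sublinear:
  fixes P :: "'a::real_vector \<Rightarrow> real"
  assumes P: "sublinear P"
  obtains l where "linear l" "\<And>x. l x \<le> P x"
proof -
  define A where "A = {p. sublinear p \<and> p \<le> P}"
  have "\<exists>q\<in>A. \<forall>p\<in>A. p \<le> q \<longrightarrow> p = q"
  proof (rule predicate_Zorn)
    show "partial_order_on A (relation_of (\<lambda>q p. p \<le> q) A)"
      by (rule partial_order_on_relation_ofI) auto
  next
    fix \<C>
    assume "\<C> \<in> Chains (relation_of (\<lambda>q p. p \<le> q) A)"
    then have sub: "\<C> \<subseteq> A" and lin: "\<And>p q. p \<in> \<C> \<Longrightarrow> q \<in> \<C> \<Longrightarrow> p \<le> q \<or> q \<le> p"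
      by (auto simp: Chains_def relation_of_def)
    show "\<exists>q\<in>A. \<forall>p\<in>\<C>. q \<le> p"
    proof (cases "\<C> = {}")
      case True
      then show ?thesis using P by (auto simp: A_def)
    next
      case False
      let ?q = "\<lambda>x. INF p\<in>\<C>. p x"
      have A: "sublinear p" "p x \<le> P x" if "p \<in> \<C>" for p x
        using sub that by (auto simp: A_def le_fun_def)
      have inf: "sublinear ?q" "\<And>p x. p \<in> \<C> \<Longrightarrow> ?q x \<le> p x"
        by (rule sublinear_INF_chain[of \<C> P]; use False A lin in blast)+
      obtain p where "p \<in> \<C>" using False by blast
      then have "?q \<le> P" using inf(2) A(2) order_trans by (fastforce simp: le_fun_def)
      with inf show ?thesis by (intro bexI[of _ ?q]) (auto simp: A_def le_fun_def)
    qed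
  qed
  then obtain q where q: "sublinear q" "q \<le> P"
    and min: "\<And>p. sublinear p \<Longrightarrow> p \<le> P \<Longrightarrow> p \<le> q \<Longrightarrow> p = q"
    by (auto simp: A_def)
  have add: "q (x + w) = q x + q w" for x w
  proof (rule antisym)
    have "sublinear_shift q w \<le> q"
      using sublinear_shift_le[OF q(1), of 0] by (auto simp: le_fun_def)
    with q(2) have "sublinear_shift q w = q"
      by (intro min sublinear_sublinear_shift q(1)) (auto intro: order_trans)
    then show "q x + q w \<le> q (x + w)"
      using sublinear_shift_le[OF q(1), of 1 w x] by simp
  qed (rule sublinear_add[OF q(1)])
  have "q (r *\<^sub>R x) = r *\<^sub>R q x" for r x
  proof (cases "0 \<le> r")
    case False
    have "q (r *\<^sub>R x) + q ((- r) *\<^sub>R x) = 0"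
      using add[of "r *\<^sub>R x" "(- r) *\<^sub>R x"] sublinear_zero[OF q(1)] by simp
    moreover have "q ((- r) *\<^sub>R x) = (- r) * q x"
      using False by (intro sublinear_scaleR[OF q(1)]) auto
    ultimately show ?thesis by simp
  qed (simp add: sublinear_scaleR[OF q(1)])
  with add have "linear q" by (intro linearI)
  with q(2) show ?thesis by (intro that) (auto simp: le_fun_def)
qed

lemma scaleC_scaleR_commute: "c *\<^sub>C (r *\<^sub>R x) = r *\<^sub>R (c *\<^sub>C x)" for x :: "'a::complex_vector"
  unfolding scaleC_of_real[symmetric] scaleC_scaleC by (simp add: mult.commute)

text \<open>Hahn-Banach for the norm shifted by \<open>v\<close>: a linear functional below the
  shift is at most \<open>- norm v\<close> at \<open>- v\<close>, so it attains the norm at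
  \<open>v\<close>.\<close>

theorem norming_functional:
  fixes v :: "'a::complex_normed_vector"
  obtains f :: "'a dual" where "norm f \<le> 1" "f v = of_real (norm v)"
proof -
  have sn: "sublinear (norm :: 'a \<Rightarrow> real)"
    by (simp add: sublinear_def norm_triangle_ineq)
  let ?P = "sublinear_shift norm v"
  obtain l where l: "linear l" "\<And>x. l x \<le> ?P x"
    using linear_below_sublinear[OF sublinear_sublinear_shift[OF sn]] by blast
  have le: "l x \<le> norm x" for x
    using l(2)[of x] sublinear_shift_le[OF sn, of 0 v x] by simp
  have "l (- v) \<le> - norm v"
    using l(2)[of "- v"] sublinear_shift_le[OF sn, of 1 v "- v"] by simp
  then have lv: "l v = norm v" using le[of v] l(1) by (simp add: linear_neg)
  \<comment> \<open>The complex-linear functional with real part \<open>l\<close>.\<close>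
  define \<phi> where "\<phi> x = Complex (l x) (- l (\<i> *\<^sub>C x))" for x
  have split: "c *\<^sub>C x = Re c *\<^sub>R x + Im c *\<^sub>R (\<i> *\<^sub>C x)" for c and x :: 'a
    unfolding scaleC_of_real[symmetric] scaleC_scaleC scaleC_add_left[symmetric]
    by (simp add: mult.commute complex_eq[symmetric])
  have ii: "\<i> *\<^sub>C \<i> *\<^sub>C x = - x" for x :: 'a
    using scaleC_of_real[of "-1" x] by (simp add: scaleC_scaleC)
  have sc: "\<phi> (c *\<^sub>C x) = c * \<phi> x" for c x
  proof -
    have "\<i> *\<^sub>C (c *\<^sub>C x) = Re c *\<^sub>R (\<i> *\<^sub>C x) - Im c *\<^sub>R x"
      unfolding split[of c x] by (simp add: scaleC_add_right scaleC_scaleR_commute ii)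
    then show ?thesis
      using l(1) by (simp add: \<phi>_def split[of c x] complex_eq_iff linear_add linear_diff linear_scale)
  qed
  have bound: "norm (\<phi> x) \<le> norm x" for x
  proof (cases "\<phi> x = 0")
    case False
    \<comment> \<open>The phase \<open>u\<close> rotates \<open>\<phi> x\<close> to its modulus, so
      the bound on the real part \<open>l\<close> bounds the modulus.\<close>
    define u where "u = cnj (sgn (\<phi> x))"
    have u: "cmod u = 1" using False by (simp add: u_def norm_sgn)
    have "\<phi> x * cnj (\<phi> x) = of_real (norm (\<phi> x)) * of_real (norm (\<phi> x))"
      using complex_norm_square[of "\<phi> x"] by (simp add: power2_eq_square)
    then have "u * \<phi> x = of_real (norm (\<phi> x))"
      using False by (simp add: u_def sgn_eq field_simps)
    then have "norm (\<phi> x) = Re (\<phi> (u *\<^sub>C x))" by (simp add: sc)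
    also have "\<dots> \<le> norm (u *\<^sub>C x)" using le by (simp add: \<phi>_def)
    finally show ?thesis by (simp add: norm_scaleC u)
  qed simp
  have bc: "bounded_clinear \<phi>"
  proof (rule bounded_clinearI[where K = 1])
    show "\<phi> (x + y) = \<phi> x + \<phi> y" for x y
      using l(1) by (simp add: \<phi>_def scaleC_add_right linear_add complex_eq_iff)
  qed (use sc bound in \<open>auto simp: scaleC_complex_def\<close>)
  then have app: "cblinfun_apply (CBlinfun \<phi>) = \<phi>" by (simp add: CBlinfun_inverse)
  show ?thesis
  proof (rule that[of "CBlinfun \<phi>"])
    show "norm (CBlinfun \<phi>) \<le> 1"
      using bound by (intro norm_cblinfun_bound) (auto simp: app)
    have Re: "Re (\<phi> v) = norm v" by (simp add: \<phi>_def lv)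
    \<comment> \<open>The real part already exhausts the bound on the modulus, leaving no imaginary
      part.\<close>
    have "(norm v)\<^sup>2 + (Im (\<phi> v))\<^sup>2 \<le> (norm v)\<^sup>2"
      using power_mono[OF bound[of v], of 2] by (simp add: cmod_power2 Re)
    then have "Im (\<phi> v) = 0" by simp
    with Re show "CBlinfun \<phi> v = of_real (norm v)" by (simp add: app complex_eq_iff)
  qed
qed

section \<open>Functionals of the form \<open>x \<otimes> y\<close>\<close>

text \<open>The assumption at \<open>v = 0\<close> forces \<open>b \<ge> 0\<close>, so the lemma
  also serves for a bound whose sign is not known beforehand.\<close>

lemma norm_cblinfun_bound_cball:
  assumes "\<And>v. norm v \<le> 1 \<Longrightarrow> norm (cblinfun_apply T v) \<le> b"
  shows "norm T \<le> b"
proof (rule norm_cblinfun_bound)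
  show "0 \<le> b" using order_trans[OF norm_ge_zero assms[of 0]] by simp
  show "norm (cblinfun_apply T v) \<le> b * norm v" for v
  proof (cases "v = 0")
    case False
    then have "norm (cblinfun_apply T (v /\<^sub>R norm v)) \<le> b" by (intro assms) simp
    with False show ?thesis by (simp add: cblinfun_linear_simps field_simps)
  qed (simp add: cblinfun_linear_simps)
qed

lemma norm_cblinfun_cball:
  assumes "norm T \<le> 1"
  shows "norm (cblinfun_apply T v) \<le> norm v"
  using norm_cblinfun[of T v] mult_right_mono[OF assms norm_ge_zero, of v] by simp

lift_definition canonical_embedding :: "'a::complex_normed_vector \<Rightarrow> 'a dual dual"
  is "\<lambda>v f. cblinfun_apply f v"
proof -
  fix v :: 'a
  show "bounded_clinear (\<lambda>f :: 'a dual. cblinfun_apply f v)"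
    by (rule bounded_clinearI[where K = "norm v"])
      (simp_all add: cblinfun_apply_simps norm_cblinfun)
qed

lemma norm_canonical_embedding_le: "norm (canonical_embedding v) \<le> norm v"
  using norm_cblinfun[of _ v]
  by (intro norm_cblinfun_bound) (simp_all add: canonical_embedding.rep_eq mult.commute)

lemma linear_tensor_functional_left: "linear (\<lambda>x. x \<otimes>\<^sub>f y)"
  by (intro linearI cblinfun_eqI) (simp_all add: tensor_functional_apply cblinfun_apply_simps)

lemma linear_tensor_functional_right: "linear (\<lambda>y. x \<otimes>\<^sub>f y)"
  by (intro linearI cblinfun_eqI)
    (simp_all add: tensor_functional_apply cblinfun_apply_simps cblinfun_linear_simps)

lemma norm_tensor_functional_le: "norm (x \<otimes>\<^sub>f y) \<le> norm x * norm y"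
proof (rule norm_cblinfun_bound)
  fix T :: "'a \<Rightarrow>\<^sub>C\<^sub>L 'b"
  have "norm (x (adj T y)) \<le> norm x * norm (adj T y)" by (rule norm_cblinfun)
  also have "\<dots> \<le> norm x * (norm y * norm T)"
    by (simp add: adj.rep_eq norm_cblinfun_compose mult_left_mono)
  finally show "norm ((x \<otimes>\<^sub>f y) T) \<le> norm x * norm y * norm T"
    by (simp add: tensor_functional_apply mult.assoc)
qed simp

lemma tensor_functional_in_cball:
  "x \<in> cball 0 1 \<Longrightarrow> y \<in> cball 0 1 \<Longrightarrow> x \<otimes>\<^sub>f y \<in> cball 0 1"
  using norm_tensor_functional_le[of x y] mult_le_one[of "norm x" "norm y"] by simp

text \<open>An operator \<open>T\<close> separating \<open>f\<close> from the closed hull at level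
  \<open>c\<close> would satisfy \<open>norm T \<le> - c\<close>, as evaluation at \<open>v\<close>
  followed by a functional norming \<open>T v\<close> recovers \<open>norm (T v)\<close>. This
  contradicts \<open>Re (f T) < c\<close> and \<open>norm f \<le> 1\<close>.\<close>

lemma cball_subset_closure_hull_tensor_functional:
  "cball 0 1 \<subseteq> weak_star closure_of (convex hull
    {x \<otimes>\<^sub>f y | (x :: 'a::complex_normed_vector dual dual) (y :: 'b::complex_normed_vector dual).
      x \<in> cball 0 1 \<and> y \<in> cball 0 1})" (is "_ \<subseteq> ?C")
proof (rule ccontr)
  let ?W = "{x \<otimes>\<^sub>f y | (x :: 'a dual dual) (y :: 'b dual). x \<in> cball 0 1 \<and> y \<in> cball 0 1}"
  assume "\<not> cball 0 1 \<subseteq> ?C"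
  then obtain f where "f \<in> cball 0 1" and fC: "f \<notin> ?C" by blast
  then have f: "norm f \<le> 1" by simp
  have "?W \<subseteq> cball 0 1" using tensor_functional_in_cball by blast
  then have "?C \<subseteq> cball 0 1"
    by (intro closure_of_minimal hull_minimal compactin_imp_closedin[OF Hausdorff_weak_star]
        Banach_Alaoglu convex_cball)
  then have "compactin weak_star ?C"
    by (intro closed_compactin[OF Banach_Alaoglu]) auto
  from weak_star_separation[OF this convex_closure_of_weak_star[OF convex_convex_hull] fC]
  obtain T c where T: "Re (f T) < c" "\<forall>g\<in>?C. c \<le> Re (g T)"
    by blast
  have "norm (T v) \<le> - c" if v: "norm v \<le> 1" for v
  proof -
    obtain y :: "'b dual" where y: "norm y \<le> 1" "y (T v) = of_real (norm (T v))"
      using norming_functional by blast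
    \<comment> \<open>The sign turns the lower bound \<open>c\<close> on the hull into the upper
      bound \<open>- c\<close> on \<open>norm (T v)\<close>.\<close>
    let ?x = "- canonical_embedding v"
    have "?x \<otimes>\<^sub>f y \<in> ?W"
      using norm_canonical_embedding_le[of v] v y by (intro CollectI exI conjI refl) auto
    then have "?x \<otimes>\<^sub>f y \<in> ?C"
      by (intro subsetD[OF closure_of_subset] hull_inc) auto
    then have "c \<le> Re ((?x \<otimes>\<^sub>f y) T)" using T(2) by blast
    then show ?thesis
      using y by (simp add: tensor_functional_apply cblinfun_apply_simps canonical_embedding.rep_eq
          adj_apply)
  qed
  then have "norm T \<le> - c" by (rule norm_cblinfun_bound_cball)
  moreover have "norm (f T) \<le> norm T" using norm_cblinfun_cball[OF f] .
  moreover have "- norm (f T) \<le> Re (f T)" using abs_Re_le_cmod[of "f T"] by simp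
  ultimately show False using T(1) by simp
qed

section \<open>Compact operators and weak-star continuity\<close>

lemma continuous_map_euclidean_metric:
  assumes "\<And>z e. z \<in> topspace X \<Longrightarrow> 0 < e \<Longrightarrow>
    \<exists>U. openin X U \<and> z \<in> U \<and> (\<forall>w\<in>U. dist (f z) (f w) < e)"
  shows "continuous_map X euclidean f"
proof -
  have "continuous_map X Met_TC.mtopology f"
    unfolding Met_TC.continuous_map_to_metric using assms by simp
  then show ?thesis by simp
qed

text \<open>Compactness of \<open>T\<close> supplies a finite net for the image of the unit ball;
  weak-star closeness at the net points controls \<open>adj T\<close> uniformly, hence in
  norm.\<close>

lemma continuous_map_compact_operator_adj:
  fixes T :: "'a::complex_normed_vector \<Rightarrow>\<^sub>C\<^sub>L 'b::complex_normed_vector"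
  assumes "T \<in> compact_operators"
  shows "continuous_map (subtopology weak_star (cball 0 1)) euclidean (cblinfun_apply (adj T))"
proof (rule continuous_map_euclidean_metric)
  fix z :: "'b dual" and e :: real
  assume "z \<in> topspace (subtopology weak_star (cball 0 1))" and e: "0 < e"
  then have z: "norm z \<le> 1" by simp
  \<comment> \<open>Three errors of size \<open>d\<close> occur: one at the net point, and one each
    for \<open>z\<close> and \<open>w\<close> between the net point and \<open>T v\<close>. The
    fourth quarter keeps the inequality strict.\<close>
  define d where "d = e / 4"
  have d: "0 < d" using e by (simp add: d_def)
  have "compact (closure (T ` cball 0 1))" using assms by (simp add: compact_operators_def)
  then obtain k where k: "finite k" "closure (T ` cball 0 1) \<subseteq> (\<Union>a\<in>k. ball a d)"
    using d unfolding compact_eq_totally_bounded by metis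
  define U where "U = (\<Inter>a\<in>k. {y. cblinfun_apply y a \<in> ball (z a) d}) \<inter> topspace weak_star"
  have "openin weak_star {y. cblinfun_apply y a \<in> ball (z a) d}" for a
    using openin_continuous_map_preimage[OF continuous_map_weak_star_apply, of "ball (z a) d" a] by simp
  then have "openin weak_star U"
    unfolding U_def using k(1) by (intro openin_INT) auto
  then have "openin (subtopology weak_star (cball 0 1)) (U \<inter> cball 0 1)"
    by (auto simp: openin_subtopology)
  moreover have "z \<in> U \<inter> cball 0 1" using z d by (auto simp: U_def)
  moreover have "dist (adj T z) (adj T w) < e" if w: "w \<in> U \<inter> cball 0 1" for w
  proof -
    have "norm (adj T z - adj T w) \<le> 3 * d"
    proof (rule norm_cblinfun_bound_cball)
      fix v :: 'a
      assume "norm v \<le> 1"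
      then have "T v \<in> closure (T ` cball 0 1)"
        by (intro subsetD[OF closure_subset]) auto
      then obtain a where a: "a \<in> k" "dist a (T v) < d" using k(2) by auto
      have za: "norm (z a - w a) < d"
        using w a(1) by (auto simp: U_def dist_norm)
      have n: "norm (z (T v - a)) \<le> d" "norm (w (T v - a)) \<le> d"
        using norm_cblinfun_cball[of z "T v - a"] norm_cblinfun_cball[of w "T v - a"] z w a(2)
        by (auto simp: dist_norm norm_minus_commute)
      have "(adj T z - adj T w) v = (z a - w a) + (z (T v - a) - w (T v - a))"
        by (simp add: cblinfun_apply_simps cblinfun_linear_simps adj_apply)
      also have "norm \<dots> \<le> norm (z a - w a) + (norm (z (T v - a)) + norm (w (T v - a)))"
        by (intro order_trans[OF norm_triangle_ineq] add_left_mono norm_triangle_ineq4)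
      finally show "norm ((adj T z - adj T w) v) \<le> 3 * d" using za n by simp
    qed
    with d show ?thesis by (simp add: dist_norm d_def)
  qed
  ultimately show "\<exists>U. openin (subtopology weak_star (cball 0 1)) U \<and> z \<in> U \<and>
      (\<forall>w\<in>U. dist (adj T z) (adj T w) < e)"
    by blast
qed

text \<open>First \<open>x\<close> moves at the fixed vector \<open>adj T y\<close>, then
  \<open>y\<close> moves: the second change is at most the norm distance of the adjoint values,
  uniformly over \<open>x'\<close> in the ball.\<close>

lemma continuous_map_compact_operator_tensor:
  fixes T :: "'a::complex_normed_vector \<Rightarrow>\<^sub>C\<^sub>L 'b::complex_normed_vector"
  assumes "T \<in> compact_operators"
  shows "continuous_map
    (prod_topology (subtopology weak_star (cball 0 1)) (subtopology weak_star (cball 0 1)))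
    euclidean (\<lambda>p. cblinfun_apply (fst p) (adj T (snd p)))" (is "continuous_map (prod_topology ?X ?Y) _ _")
proof (rule continuous_map_euclidean_metric)
  fix p :: "'a dual dual \<times> 'b dual" and e :: real
  assume p: "p \<in> topspace (prod_topology ?X ?Y)" and e: "0 < e"
  obtain x y where xy: "p = (x, y)" "norm x \<le> 1" "norm y \<le> 1" using p by auto
  let ?U = "{x' \<in> topspace ?X. cblinfun_apply x' (adj T y) \<in> ball (x (adj T y)) (e / 2)}"
  let ?V = "{y' \<in> topspace ?Y. adj T y' \<in> ball (adj T y) (e / 2)}"
  have "openin ?X ?U"
    using continuous_map_from_subtopology[OF continuous_map_weak_star_apply]
    by (rule openin_continuous_map_preimage) simp
  moreover have "openin ?Y ?V"
    using continuous_map_compact_operator_adj[OF assms]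
    by (rule openin_continuous_map_preimage) simp
  ultimately have "openin (prod_topology ?X ?Y) (?U \<times> ?V)"
    by (simp add: openin_prod_Times_iff)
  moreover have "p \<in> ?U \<times> ?V" using xy e by simp
  moreover have "dist (x (adj T y)) (x' (adj T y')) < e" if "x' \<in> ?U" "y' \<in> ?V" for x' y'
  proof -
    have "dist (x' (adj T y)) (x' (adj T y')) \<le> dist (adj T y) (adj T y')"
      using norm_cblinfun_cball[of x' "adj T y - adj T y'"] that(1)
      by (simp add: dist_norm cblinfun_linear_simps)
    moreover have "dist (x (adj T y)) (x' (adj T y')) \<le>
        dist (x (adj T y)) (x' (adj T y)) + dist (x' (adj T y)) (x' (adj T y'))"
      by (rule dist_triangle)
    ultimately show ?thesis using that by simp
  qed
  ultimately show "\<exists>U. openin (prod_topology ?X ?Y) U \<and> p \<in> U \<and>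
      (\<forall>q\<in>U. dist (cblinfun_apply (fst p) (adj T (snd p))) (cblinfun_apply (fst q) (adj T (snd q))) < e)"
    using xy(1) by (intro exI[of _ "?U \<times> ?V"]) auto
qed

lemma continuous_map_into_functions:
  "continuous_map X euclidean h \<longleftrightarrow> (\<forall>k. continuous_map X euclidean (\<lambda>z. h z k))"
  unfolding euclidean_product_topology[symmetric] by (rule continuous_map_componentwise_UNIV)

text \<open>The set is the preimage, under restriction to \<open>J\<close>, of a continuous image of
  the compact product of the two balls.\<close>

lemma closedin_weak_star_tensor_on:
  fixes J :: "('a::complex_normed_vector \<Rightarrow>\<^sub>C\<^sub>L 'b::complex_normed_vector) set"
  assumes "J \<subseteq> compact_operators"
  shows "closedin weak_star
    {g. \<exists>x\<in>cball 0 1. \<exists>y\<in>cball 0 1. \<forall>T\<in>J. cblinfun_apply g T = cblinfun_apply x (adj T y)}"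
proof -
  let ?B = "prod_topology (subtopology weak_star (cball 0 1)) (subtopology weak_star (cball 0 1))
    :: ('a dual dual \<times> 'b dual) topology"
  \<comment> \<open>Restriction to \<open>J\<close> is encoded by the value 0 off \<open>J\<close>,
    so that it maps into total functions with the product topology.\<close>
  let ?r = "\<lambda>g :: ('a \<Rightarrow>\<^sub>C\<^sub>L 'b) dual. \<lambda>T. if T \<in> J then g T else 0"
  let ?s = "\<lambda>(p :: 'a dual dual \<times> 'b dual) T. if T \<in> J then cblinfun_apply (fst p) (adj T (snd p)) else 0"
  have "continuous_map weak_star euclidean ?r"
    unfolding continuous_map_into_functions by (simp add: continuous_map_weak_star_apply)
  moreover have "closedin euclidean (?s ` (cball 0 1 \<times> cball 0 1))"
  proof (rule compactin_imp_closedin[OF Hausdorff_space_functions image_compactin])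
    show "compactin ?B (cball 0 1 \<times> cball 0 1)"
      by (simp add: compactin_Times compactin_subtopology Banach_Alaoglu)
    show "continuous_map ?B euclidean ?s"
      unfolding continuous_map_into_functions
      using assms by (auto intro: continuous_map_compact_operator_tensor)
  qed
  ultimately have "closedin weak_star {g \<in> topspace weak_star. ?r g \<in> ?s ` (cball 0 1 \<times> cball 0 1)}"
    by (rule closedin_continuous_map_preimage)
  also have "{g \<in> topspace weak_star. ?r g \<in> ?s ` (cball 0 1 \<times> cball 0 1)} =
      {g. \<exists>x\<in>cball 0 1. \<exists>y\<in>cball 0 1. \<forall>T\<in>J. cblinfun_apply g T = cblinfun_apply x (adj T y)}"
    by (force simp: fun_eq_iff image_iff)
  finally show ?thesis .
qed

section \<open>Extreme points in the range of the M-ideal projection\<close>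

text \<open>The difference \<open>g - f\<close> annihilates \<open>J\<close>, so
  \<open>P g = f\<close>; as \<open>norm f = 1\<close>, the norm identity leaves no room for
  \<open>g - P g\<close>.\<close>

lemma M_ideal_projection_eqI:
  assumes P: "M_ideal_projection J P" and f: "P f = f" "norm f = 1"
    and g: "norm g \<le> 1" "\<And>T. T \<in> J \<Longrightarrow> cblinfun_apply g T = cblinfun_apply f T"
  shows "g = f"
proof -
  have "module_hom scaleC scaleC P"
    using P by (simp add: M_ideal_projection_def module_hom_iff_linear)
  then have "P (g - f) = P g - P f" by (rule module_hom.diff)
  moreover have "g - f \<in> annihilator J" using g(2) by (simp add: annihilator_def cblinfun_apply_simps)
  then have "P (g - f) = 0" using P unfolding M_ideal_projection_def by blast
  ultimately have "P g = f" using f(1) by simp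
  moreover have "norm g = norm (P g) + norm (g - P g)"
    using P unfolding M_ideal_projection_def by blast
  ultimately show ?thesis using f(2) g(1) by simp
qed

text \<open>Milman's theorem only provides \<open>f = x \<otimes> y\<close> on \<open>J\<close> with \<open>x\<close>, \<open>y\<close> in the unit balls; the sets of
  admissible \<open>x\<close> and, for fixed \<open>x\<close>, of admissible \<open>y\<close> are weak-star compact faces, so both can be
  chosen extreme.\<close>

lemma extreme_point_eq_tensor_functional:
  fixes J :: "('a::complex_normed_vector \<Rightarrow>\<^sub>C\<^sub>L 'b::complex_normed_vector) set"
  assumes J: "J \<subseteq> compact_operators" and P: "M_ideal_projection J P"
    and f: "f extreme_point_of cball 0 1" "P f = f" "norm f = 1"
  shows "\<exists>x y. x extreme_point_of cball 0 1 \<and> y extreme_point_of cball 0 1 \<and> f = x \<otimes>\<^sub>f y"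
proof -
  let ?W = "{x \<otimes>\<^sub>f y | (x :: 'a dual dual) (y :: 'b dual). x \<in> cball 0 1 \<and> y \<in> cball 0 1}"
  let ?D = "{g :: ('a \<Rightarrow>\<^sub>C\<^sub>L 'b) dual. \<exists>x\<in>cball 0 1. \<exists>y\<in>cball 0 1.
      \<forall>T\<in>J. cblinfun_apply g T = cblinfun_apply x (adj T y)}"
  have "f \<in> weak_star closure_of ?W"
    using tensor_functional_in_cball cball_subset_closure_hull_tensor_functional
    by (intro Milman_weak_star[OF f(1) Banach_Alaoglu convex_cball]) blast+
  also have "weak_star closure_of ?W \<subseteq> ?D"
    using tensor_functional_apply by (intro closure_of_minimal closedin_weak_star_tensor_on[OF J]) blast
  finally obtain x0 :: "'a dual dual" and y0 :: "'b dual"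
    where xy0: "x0 \<in> cball 0 1" "y0 \<in> cball 0 1" "\<forall>T\<in>J. f T = x0 (adj T y0)"
    by blast
  \<comment> \<open>Agreement on \<open>J\<close> is enough: uniqueness of the norm-preserving
    extension turns it into equality on all operators.\<close>
  have tensor_eq: "x \<otimes>\<^sub>f y = f \<longleftrightarrow> (\<forall>T\<in>J. x (adj T y) = f T)"
    if "x \<in> cball 0 1" "y \<in> cball 0 1" for x y
    using M_ideal_projection_eqI[OF P f(2,3), of "x \<otimes>\<^sub>f y"] tensor_functional_in_cball[OF that]
    by (auto simp: tensor_functional_apply)
  have face: "{f} face_of cball 0 1" using f(1) by (simp add: face_of_singleton)
  let ?X = "{x \<in> cball 0 1. x \<otimes>\<^sub>f y0 \<in> {f}}"
  have X: "?X face_of cball 0 1"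
    using xy0(2) tensor_functional_in_cball
    by (intro face_of_linear_vimage[OF linear_tensor_functional_left convex_cball _ face]) blast
  have "continuous_map weak_star weak_star (\<lambda>x. x \<otimes>\<^sub>f y0)"
    by (rule continuous_map_into_weak_star) (simp add: tensor_functional_apply continuous_map_weak_star_Re)
  then have "closedin weak_star {x \<in> topspace weak_star. x \<otimes>\<^sub>f y0 \<in> {f}}"
    by (rule closedin_continuous_map_preimage) (simp add: closedin_Hausdorff_singleton Hausdorff_weak_star)
  from closed_Int_compactin[OF this Banach_Alaoglu] have "compactin weak_star ?X"
    by (simp add: Int_def conj_commute)
  moreover have "convex ?X" using X by (simp add: face_of_def)
  moreover have "x0 \<in> ?X" using xy0 tensor_eq by auto
  ultimately obtain x where "x extreme_point_of ?X"
    using extreme_point_exists_weak_star by blast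
  then have x: "x extreme_point_of cball 0 1" "x \<in> ?X"
    using extreme_point_of_face[OF X] by auto
  let ?Y = "{y \<in> cball 0 1. x \<otimes>\<^sub>f y \<in> {f}}"
  have Y: "?Y face_of cball 0 1"
    using x(2) tensor_functional_in_cball
    by (intro face_of_linear_vimage[OF linear_tensor_functional_right convex_cball _ face]) blast
  \<comment> \<open>For \<open>x\<close> in the bidual and noncompact \<open>T\<close>, the map
    \<open>y \<mapsto> x (adj T y)\<close> need not be weak-star continuous. On the compact
    operators in \<open>J\<close> it is so on the ball, hence closedness of \<open>?Y\<close> is
    tested on \<open>J\<close>.\<close>
  let ?r = "\<lambda>y T. if T \<in> J then cblinfun_apply x (adj T y) else 0"
  have "continuous_map (subtopology weak_star (cball 0 1)) euclidean (\<lambda>y. x (adj T y))"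
    if "T \<in> J" for T
  proof -
    have "continuous_map euclidean euclidean (cblinfun_apply x)"
      using linear_continuous_on[OF bounded_linear_cblinfun_apply] by simp
    moreover have "T \<in> compact_operators" using that J by blast
    ultimately show ?thesis
      using continuous_map_compose[OF continuous_map_compact_operator_adj, of T euclidean "cblinfun_apply x"]
      by (simp add: comp_def)
  qed
  then have "continuous_map (subtopology weak_star (cball 0 1)) euclidean ?r"
    unfolding continuous_map_into_functions by simp
  then have "closedin (subtopology weak_star (cball 0 1))
      {y \<in> topspace (subtopology weak_star (cball 0 1)). ?r y \<in> {\<lambda>T. if T \<in> J then f T else 0}}"
    by (rule closedin_continuous_map_preimage)
      (simp only: closedin_Hausdorff_singleton[OF Hausdorff_space_functions] topspace_euclidean UNIV_I)
  also have "{y \<in> topspace (subtopology weak_star (cball 0 1)).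
      ?r y \<in> {\<lambda>T. if T \<in> J then f T else 0}} = ?Y"
    using x(2) tensor_eq by (auto simp: fun_eq_iff)
  finally have "closedin weak_star ?Y"
    using compactin_imp_closedin[OF Hausdorff_weak_star Banach_Alaoglu] by (rule closedin_trans_full)
  then have "compactin weak_star ?Y" by (intro closed_compactin[OF Banach_Alaoglu]) auto
  moreover have "convex ?Y" using Y by (simp add: face_of_def)
  moreover have "y0 \<in> ?Y" using xy0 x(2) by auto
  ultimately obtain y where "y extreme_point_of ?Y"
    using extreme_point_exists_weak_star by blast
  then have "y extreme_point_of cball 0 1" "y \<in> ?Y"
    using extreme_point_of_face[OF Y] by auto
  with x(1) show ?thesis by blast
qed

section \<open>Support functionals\<close>

text \<open>A number of modulus at most 1 with real part 1 equals 1. From this real form, closedness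
  and the face property can be read off.\<close>

lemma support_functionals_eq:
  assumes "norm v = 1"
  shows "support_functionals v = {f \<in> cball 0 1. Re (cblinfun_apply f v) = 1}"
proof (intro equalityI subsetI)
  fix f
  assume "f \<in> {f \<in> cball 0 1. Re (cblinfun_apply f v) = 1}"
  then have f: "norm f \<le> 1" "Re (f v) = 1" by auto
  have le: "norm (f v) \<le> norm f" using norm_cblinfun[of f v] assms by simp
  have "1 \<le> norm (f v)" using complex_Re_le_cmod[of "f v"] f(2) by simp
  with le f(1) have 1: "norm f = 1" "norm (f v) = 1" by auto
  then have "Im (f v) = 0" using cmod_power2[of "f v"] f(2) by simp
  with 1 f(2) assms show "f \<in> support_functionals v"
    by (simp add: support_functionals_def complex_eq_iff)
qed (use assms in \<open>auto simp: support_functionals_def\<close>)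

lemma face_of_support_functionals:
  assumes "norm v = 1"
  shows "support_functionals v face_of cball 0 1"
proof -
  \<comment> \<open>The maximum at \<open>v\<close> is treated as a minimum at
    \<open>- v\<close>.\<close>
  have "- 1 \<le> Re (g (- v))" if "g \<in> cball 0 1" for g :: "'a dual"
    using norm_cblinfun_cball[of g v] complex_Re_le_cmod[of "g v"] that assms
    by (simp add: cblinfun_linear_simps)
  from face_of_Re_minimum[of "cball 0 1", OF convex_cball this] show ?thesis
    unfolding support_functionals_eq[OF assms] by (simp add: cblinfun_linear_simps)
qed

lemma compactin_support_functionals:
  assumes "norm v = 1"
  shows "compactin weak_star (support_functionals v)"
  using closed_Int_compactin[OF closedin_weak_star_Re_eq Banach_Alaoglu, of v 1]
  by (simp add: support_functionals_eq[OF assms] Int_def conj_commute)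

lemma M_ideal_projection_support_functional:
  assumes P: "M_ideal_projection J P" and v: "norm v = 1" "infdist v J < 1"
    and f: "f \<in> support_functionals v" and J: "J \<noteq> {}"
  shows "P f = f"
proof (rule ccontr)
  assume "P f \<noteq> f"
  define h where "h = f - P f"
  have h0: "0 < norm h" using \<open>P f \<noteq> f\<close> by (simp add: h_def)
  have "module_hom scaleC scaleC P"
    using P by (simp add: M_ideal_projection_def module_hom_iff_linear)
  then have "P h = P f - P (P f)" unfolding h_def by (rule module_hom.diff)
  moreover have "P \<circ> P = P" using P unfolding M_ideal_projection_def by blast
  then have "P (P f) = P f" by (metis comp_apply)
  ultimately have "P h = 0" by simp
  then have h: "h \<in> annihilator J" using P unfolding M_ideal_projection_def by blast
  \<comment> \<open>Here \<open>J \<noteq> {}\<close> matters: \<open>infdist\<close> to the empty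
    set is 0 by convention and would yield no \<open>j\<close>.\<close>
  obtain j where j: "j \<in> J" "dist v j < 1"
    using v(2) J cInf_lessD[of "dist v ` J" 1] by (auto simp: infdist_notempty)
  \<comment> \<open>As \<open>h\<close> vanishes at \<open>j\<close>, its value at \<open>v\<close>
    falls strictly short of \<open>norm h\<close>, whereas \<open>f\<close> must attain
    \<open>norm (P f) + norm h\<close> at \<open>v\<close>.\<close>
  have "h v = h (v - j)" using h j(1) by (simp add: annihilator_def cblinfun_linear_simps)
  then have "norm (h v) \<le> norm h * norm (v - j)" using norm_cblinfun[of h "v - j"] by simp
  also have "\<dots> < norm h" using h0 j(2) by (simp add: dist_norm)
  finally have hv: "norm (h v) < norm h" .
  have "norm f = norm (P f) + norm h"
    using P unfolding M_ideal_projection_def h_def by blast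
  moreover have "norm f = 1" "f v = 1" using f v(1) by (auto simp: support_functionals_def)
  moreover have "f v = P f v + h v" by (simp add: h_def cblinfun_apply_simps)
  then have "norm (f v) \<le> norm (P f v) + norm (h v)" by (simp add: norm_triangle_ineq)
  moreover have "norm (P f v) \<le> norm (P f)" using norm_cblinfun[of "P f" v] v(1) by simp
  ultimately show False using hv by simp
qed

theorem corollary3:
  fixes J :: "('a::complex_banach \<Rightarrow>\<^sub>C\<^sub>L 'b::complex_banach) set"
    and A :: "'a \<Rightarrow>\<^sub>C\<^sub>L 'b"
  assumes "J \<subseteq> compact_operators"
    and "M_ideal J"
    and "norm A = 1"
    and "infdist A J < 1"
  shows "support_functionals A =
    weak_star closure_of (convex hull
      {x \<otimes>\<^sub>f y | (x :: 'a dual dual) (y :: 'b dual).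
        (x \<otimes>\<^sub>f y) extreme_point_of (M_ideal_dual J \<inter> cball 0 1) \<and>
        x (adj A y) = 1 \<and>
        x extreme_point_of cball 0 1 \<and>
        y extreme_point_of cball 0 1})"
    (is "?K = weak_star closure_of (convex hull ?S)")
proof -
  obtain P where P: "M_ideal_projection J P" using assms(2) by (auto simp: M_ideal_def)
  interpret vector_space "scaleC :: complex \<Rightarrow> ('a \<Rightarrow>\<^sub>C\<^sub>L 'b) \<Rightarrow> _" by (rule vector_space_scaleC)
  have "J \<noteq> {}" using assms(2) subspace_0 by (auto simp: M_ideal_def)
  note Pf = M_ideal_projection_support_functional[OF P assms(3,4) _ this]
  have face: "?K face_of cball 0 1" by (rule face_of_support_functionals[OF assms(3)])
  have compact: "compactin weak_star ?K" by (rule compactin_support_functionals[OF assms(3)])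
  have convex: "convex ?K" using face by (simp add: face_of_def)
  have "{f. f extreme_point_of ?K} \<subseteq> ?S"
  proof clarify
    fix f
    assume "f extreme_point_of ?K"
    then have f: "f extreme_point_of cball 0 1" "f \<in> ?K"
      using extreme_point_of_face[OF face] by auto
    then have "norm f = 1" "f A = 1" using assms(3) by (auto simp: support_functionals_def)
    obtain x y where xy: "x extreme_point_of cball 0 1" "y extreme_point_of cball 0 1" "f = x \<otimes>\<^sub>f y"
      using extreme_point_eq_tensor_functional[OF assms(1) P f(1) Pf[OF f(2)] \<open>norm f = 1\<close>] by blast
    have "f \<in> M_ideal_dual J"
      using Pf[OF f(2)] unfolding M_ideal_dual_eq[OF P] by (metis rangeI)
    \<comment> \<open>An extreme point of the whole ball stays extreme in any smaller set containing
      it.\<close>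
    then have "f extreme_point_of (M_ideal_dual J \<inter> cball 0 1)"
      using f(1) unfolding extreme_point_of_def by blast
    moreover have "x (adj A y) = 1"
      using \<open>f A = 1\<close> by (simp add: xy(3) tensor_functional_apply)
    ultimately show "\<exists>x y. f = x \<otimes>\<^sub>f y \<and> x \<otimes>\<^sub>f y extreme_point_of (M_ideal_dual J \<inter> cball 0 1) \<and>
        x (adj A y) = 1 \<and> x extreme_point_of cball 0 1 \<and> y extreme_point_of cball 0 1"
      using xy by blast
  qed
  then have "weak_star closure_of (convex hull {f. f extreme_point_of ?K}) \<subseteq>
      weak_star closure_of (convex hull ?S)"
    by (intro closure_of_mono hull_mono)
  then have "?K \<subseteq> weak_star closure_of (convex hull ?S)"
    using Krein_Milman_weak_star[OF compact convex] by simp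
  \<comment> \<open>An extreme point belongs to its set, so a member of \<open>?S\<close> lies in
    the unit ball; its value 1 at \<open>A\<close> makes it a support functional.\<close>
  moreover have "?S \<subseteq> ?K"
    unfolding support_functionals_eq[OF assms(3)]
    by (auto simp: extreme_point_of_def tensor_functional_apply)
  then have "weak_star closure_of (convex hull ?S) \<subseteq> ?K"
    using compact convex
    by (intro closure_of_minimal hull_minimal compactin_imp_closedin[OF Hausdorff_weak_star])
  ultimately show ?thesis by (rule equalityI)
qed

end
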